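(* For every constant $\epsilon\in(0,1)$ there are constants $N=N(\epsilon)>0$, $\gamma_1=\gamma_1(\epsilon)>0$ and $\gamma_2=\gamma_2(\epsilon)>0$ such that the following holds. Let $n$ be sufficiently large and $\Delta> N\log n$, and consider the online edge-coloring game $\Phi(n,\Delta,\epsilon)$. For every graph $G$ on $n$ vertices with maximum degree $\Delta$, for all but at most a $2^{-\gamma_1\Delta}$ fraction of the one-to-one mappings $\sigma:E(G)\to[m]$, the randomized greedy algorithm $\mathcal{A}$ defeats the oblivious Builder strategy $\mathbf{obl}(G,\sigma)$ (i.e. colors every edge of $G$) with probability at least $1-2^{-\gamma_2\Delta}$.
   Context: The online edge-coloring game $\Phi(n,\Delta,\epsilon)$: start with the empty graph on a fixed set of $n$ vertices and a color set $\Gamma$ with $|\Gamma|=\lceil(1+\epsilon)\Delta\rceil$. The game lasts $m=\lfloor \Delta n/2\rfloor$ steps. At each step Builder adds an edge to the graph, keeping every vertex degree at most $\Delta$, or adds a null edge (an edge incident to no vertex, which can be given any color without affecting validity). Colorer then irrevocably assigns to the new edge a color from $\Gamma$ so that the coloring stays proper (no two edges sharing a vertex get the same color); if this is impossible the edge is left uncolored. Colorer wins if every edge is colored. The free set of a vertex $v$ at a given moment is the set of colors of $\Gamma$ not yet used on a colored edge incident to $v$. The randomized greedy algorithm $\mathcal{A}$ (a Colorer strategy): when edge $(u,v)$ arrives, if the intersection of the free sets of $u$ and $v$ is nonempty, color the edge with a color chosen uniformly at random from that intersection; otherwise leave it uncolored. For a graph $G$ and a one-to-one map $\sigma:E(G)\to[m]$,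 the oblivious Builder strategy $\mathbf{obl}(G,\sigma)$ adds at step $i$ the edge $\sigma^{-1}(i)$ if it exists and a null edge otherwise. The fraction of mappings refers to the uniform distribution over all one-to-one maps $\sigma:E(G)\to[m]$; the probability is over the random choices of $\mathcal{A}$. *)

theory Defs
  imports "HOL-Probability.Probability"
begin

(* Graphs on n vertices are finite simple graphs with vertex set {..<n}, given by their edge set. *)

type_synonym edge = "nat set"
type_synonym color = nat

definition simple_graph :: "nat \<Rightarrow> edge set \<Rightarrow> bool" where
  "simple_graph n E \<longleftrightarrow> (\<forall>e\<in>E. e \<subseteq> {..<n} \<and> card e = 2)"

definition degree :: "edge set \<Rightarrow> nat \<Rightarrow> nat" where
  "degree E v = card {e \<in> E. v \<in> e}"

definition max_degree :: "nat \<Rightarrow> edge set \<Rightarrow> nat" where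
  "max_degree n E = Max (degree E ` {..<n})"

(* A history lists the edges in order of arrival, each with Some color, or None if it was left
   uncolored. The null edge is the empty set: it is incident to no vertex, so every color of the
   palette is admissible for it and its color restricts no other edge. *)

type_synonym history = "(edge \<times> color option) list"
type_synonym builder = "history \<Rightarrow> edge"
type_synonym colorer = "history \<Rightarrow> edge \<Rightarrow> color option pmf"

definition palette :: "real \<Rightarrow> nat \<Rightarrow> color set" where
  "palette \<epsilon> \<Delta> = {..<nat \<lceil>(1 + \<epsilon>) * real \<Delta>\<rceil>}"

definition game_length :: "nat \<Rightarrow> nat \<Rightarrow> nat" where
  "game_length n \<Delta> = (\<Delta> * n) div 2"

primrec play :: "builder \<Rightarrow> colorer \<Rightarrow> nat \<Rightarrow> history pmf" where
  "play B C 0 = return_pmf []"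
| "play B C (Suc k) =
     bind_pmf (play B C k) (\<lambda>h. map_pmf (\<lambda>c. h @ [(B h, c)]) (C h (B h)))"

definition legal_moves :: "nat \<Rightarrow> nat \<Rightarrow> history \<Rightarrow> bool" where
  "legal_moves n \<Delta> h \<longleftrightarrow>
     (let es = filter (\<lambda>e. e \<noteq> {}) (map fst h)
      in distinct es \<and> simple_graph n (set es) \<and> (\<forall>v<n. degree (set es) v \<le> \<Delta>))"

definition proper_coloring :: "color set \<Rightarrow> history \<Rightarrow> bool" where
  "proper_coloring \<Gamma> h \<longleftrightarrow>
     (\<forall>i<length h. \<forall>c. snd (h ! i) = Some c \<longrightarrow>
        c \<in> \<Gamma> \<and> (\<forall>j<i. fst (h ! i) \<inter> fst (h ! j) \<noteq> {} \<longrightarrow> snd (h ! j) \<noteq> Some c))"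

definition colorer_wins :: "color set \<Rightarrow> history \<Rightarrow> bool" where
  "colorer_wins \<Gamma> h \<longleftrightarrow> proper_coloring \<Gamma> h \<and> (\<forall>(e, c)\<in>set h. c \<noteq> None)"

definition win_prob :: "nat \<Rightarrow> nat \<Rightarrow> real \<Rightarrow> builder \<Rightarrow> colorer \<Rightarrow> real" where
  "win_prob n \<Delta> \<epsilon> B C =
     measure_pmf.prob (play B C (game_length n \<Delta>)) {h. colorer_wins (palette \<epsilon> \<Delta>) h}"

definition free_set :: "color set \<Rightarrow> history \<Rightarrow> nat \<Rightarrow> color set" where
  "free_set \<Gamma> h v = \<Gamma> - {c. \<exists>e. v \<in> e \<and> (e, Some c) \<in> set h}"

definition randomized_greedy :: "color set \<Rightarrow> colorer" where
  "randomized_greedy \<Gamma> h e =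
     (let A = \<Gamma> \<inter> (\<Inter>v\<in>e. free_set \<Gamma> h v)
      in if A = {} then return_pmf None else map_pmf Some (pmf_of_set A))"

definition edge_orders :: "edge set \<Rightarrow> nat \<Rightarrow> (edge \<Rightarrow> nat) set" where
  "edge_orders E m = {\<sigma> \<in> E \<rightarrow>\<^sub>E {1..m}. inj_on \<sigma> E}"

definition obl :: "edge set \<Rightarrow> (edge \<Rightarrow> nat) \<Rightarrow> builder" where
  "obl E \<sigma> h =
     (let i = Suc (length h) in if i \<in> \<sigma> ` E then inv_into E \<sigma> i else {})"

(* Oblivious strategies obey the degree restriction on Builder, whatever Colorer does; this is why
   win_prob does not have to mention it. *)

lemma obl_moves:
  assumes "h \<in> set_pmf (play (obl E \<sigma>) C k)"
  shows "map fst h = map (\<lambda>i. if Suc i \<in> \<sigma> ` E then inv_into E \<sigma> (Suc i) else {}) [0..<k]"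
  using assms
proof (induction k arbitrary: h)
  case 0
  then show ?case by simp
next
  case (Suc k)
  then obtain g c where g: "g \<in> set_pmf (play (obl E \<sigma>) C k)" and h: "h = g @ [(obl E \<sigma> g, c)]"
    by auto
  have "length g = k"
    using arg_cong[OF Suc.IH[OF g], of length] by simp
  then show ?case
    using Suc.IH[OF g] h by (simp add: obl_def)
qed

lemma obl_legal:
  assumes G: "simple_graph n E" "max_degree n E \<le> \<Delta>"
    and h: "h \<in> set_pmf (play (obl E \<sigma>) C k)"
  shows "legal_moves n \<Delta> h"
proof -
  define f where "f = (\<lambda>i. if Suc i \<in> \<sigma> ` E then inv_into E \<sigma> (Suc i) else {})"
  define es where "es = filter (\<lambda>e. e \<noteq> {}) (map fst h)"
  have es: "es = map f (filter (\<lambda>i. f i \<noteq> {}) [0..<k])"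
    unfolding es_def obl_moves[OF h] f_def[symmetric] by (simp add: filter_map o_def)
  have inE: "Suc i \<in> \<sigma> ` E" if "f i \<noteq> {}" for i
    using that unfolding f_def by (auto split: if_splits)
  have "inj_on f {i. f i \<noteq> {}}"
  proof (rule inj_onI)
    fix i j assume ij: "i \<in> {i. f i \<noteq> {}}" "j \<in> {i. f i \<noteq> {}}" and eq: "f i = f j"
    have I: "Suc i \<in> \<sigma> ` E" "Suc j \<in> \<sigma> ` E" using ij inE by auto
    then have "inv_into E \<sigma> (Suc i) = inv_into E \<sigma> (Suc j)"
      using eq by (simp add: f_def)
    then show "i = j"
      using I by (metis f_inv_into_f Suc_inject)
  qed
  then have 1: "distinct es"
    unfolding es by (auto simp: distinct_map intro: inj_on_subset)
  have sub: "set es \<subseteq> E"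
    unfolding es using inE by (auto simp: f_def inv_into_into)
  have 2: "simple_graph n (set es)"
    using G(1) sub by (auto simp: simple_graph_def)
  have "E \<subseteq> Pow {..<n}"
    using G(1) by (auto simp: simple_graph_def)
  then have fin: "finite E"
    by (rule finite_subset) simp
  have 3: "degree (set es) v \<le> \<Delta>" if "v < n" for v
  proof -
    have "degree (set es) v \<le> degree E v"
      unfolding degree_def using fin sub by (intro card_mono) auto
    also have "\<dots> \<le> max_degree n E"
      unfolding max_degree_def using that by (intro Max_ge) auto
    finally show ?thesis using G(2) by simp
  qed
  show ?thesis
    unfolding legal_moves_def using 1 2 3 by (simp add: es_def Let_def)
qed

end

(* Averaged over the order of the edges, the next edge is uniformly distributed over the slots still
   to come. Two families of quantities are tracked: for vertices u, v the ratio
   |Gamma| |F(u) Int F(v)| / (|F(u)| |F(v)|), and for a vertex v and a color c the sum of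
   |Gamma| 1[c in F(w)] / |F(w)| over the remaining neighbors w of v (together with their number).
   If both are within b of their ideal values, then every vertex uses its free colors nearly
   uniformly, and this bounds the drift of all tracked deviations by O(b/m) per move. A bound b
   that grows by the factor 1 + O(1/m) per move therefore absorbs the drift, and it stays small if
   it starts small. Exponential supermartingales and a union bound show that no deviation ever
   exceeds b during the first (1 - eps^2/64) m moves, outside an event of probability
   exp(-Omega(Delta)). At that moment any two free sets share more colors than the edges still to
   come at the two vertices can use up, so the rest of the game is safe. Markov's inequality
   separates the randomness of the order from that of the algorithm. *)

theory Submission
  imports Defs
begin

section \<open>Averages and neighborhoods\<close>

text \<open>The two families are chosen because their drifts close up. When an edge
  \<open>{w, w'}\<close> is colored, the expected change of the share of a color c at w is
  proportional to 1 minus the quotient of the share of c at w' and the overlap of w and w'. Summed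
  over the remaining w' this is a difference of two loads at w, up to the error of the overlaps, and
  both loads have the same target. So the drifts of the shares, and with them those of overlaps and
  loads, are linear in b. The sizes of the free sets need no concentration: the ratios are
  normalized by the actual sizes, and a lower bound \<epsilon>\<Delta> holds in every play. A single
  share is no candidate for tracking, as it jumps by a constant when its color is used. Overlaps and
  loads average over order \<Delta> shares, so a move changes them by O(1/\<Delta>), while the
  expected absolute change per move is O(1/m). The product of the two bounds the second moment,
  which is thus O(1/\<Delta>) over the whole game; this gives probability exp(-\<Omega>(\<Delta>))
  for a deviation of constant size. All per-move bounds are divided by the number of slots left,
  which is why tracking stops before the end.\<close>

definition mean :: "'a set \<Rightarrow> ('a \<Rightarrow> real) \<Rightarrow> real" where
  "mean A f = sum f A / real (card A)"

lemma mean_sum: "mean A (\<lambda>a. \<Sum>i\<in>I. f i a) = (\<Sum>i\<in>I. mean A (f i))"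
  unfolding mean_def by (subst sum.swap) (simp add: sum_divide_distrib)

lemma mean_mult_left: "mean A (\<lambda>a. k * f a) = k * mean A f"
  by (simp add: mean_def sum_distrib_left)

lemma mean_const: "finite A \<Longrightarrow> A \<noteq> {} \<Longrightarrow> mean A (\<lambda>a. k) = k"
  by (simp add: mean_def)

lemma mean_cong: "(\<And>a. a \<in> A \<Longrightarrow> f a = g a) \<Longrightarrow> mean A f = mean A g"
  by (simp add: mean_def cong: sum.cong)

lemma mean_mono: "(\<And>a. a \<in> A \<Longrightarrow> f a \<le> g a) \<Longrightarrow> mean A f \<le> mean A g"
  unfolding mean_def by (intro divide_right_mono sum_mono) auto

lemma abs_mean_le: "\<bar>mean A f\<bar> \<le> mean A (\<lambda>a. \<bar>f a\<bar>)"
  unfolding mean_def by (simp add: abs_divide divide_right_mono)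

lemma mean_le_const:
  assumes "\<And>a. a \<in> A \<Longrightarrow> f a \<le> k" "0 \<le> k"
  shows "mean A f \<le> k"
proof (cases "finite A \<and> A \<noteq> {}")
  case True
  then show ?thesis
    using mean_mono[of A f "\<lambda>_. k"] assms by (simp add: mean_const)
next
  case False
  then show ?thesis using assms by (auto simp: mean_def)
qed

definition nbrs :: "edge set \<Rightarrow> nat \<Rightarrow> nat set" where
  "nbrs R v = {w. {v, w} \<in> R}"

lemma sum_incident:
  assumes "\<And>e. e \<in> R \<Longrightarrow> card e = 2"
  shows "(\<Sum>e\<in>{e \<in> R. v \<in> e}. g e) = (\<Sum>w\<in>nbrs R v. g {v, w})"
proof (rule sum.reindex_bij_betw[symmetric])
  show "bij_betw (\<lambda>w. {v, w}) (nbrs R v) {e \<in> R. v \<in> e}"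
    unfolding bij_betw_def
  proof
    show "inj_on (\<lambda>w. {v, w}) (nbrs R v)"
      by (auto simp: inj_on_def doubleton_eq_iff)
    show "(\<lambda>w. {v, w}) ` nbrs R v = {e \<in> R. v \<in> e}"
    proof (intro equalityI subsetI)
      fix e assume e: "e \<in> {e \<in> R. v \<in> e}"
      then have "card e = 2" using assms by simp
      then obtain x y where "e = {x, y}" by (auto simp: card_2_iff)
      then have "\<exists>w. e = {v, w}" using e by auto
      then show "e \<in> (\<lambda>w. {v, w}) ` nbrs R v" using e by (auto simp: nbrs_def)
    qed (auto simp: nbrs_def)
  qed
qed

lemma card_nbrs:
  assumes "\<And>e. e \<in> R \<Longrightarrow> card e = 2"
  shows "card (nbrs R v) = degree R v"
  using sum_incident[of R "\<lambda>_. 1::nat" v] assms by (simp add: degree_def)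

lemma finite_nbrs: "finite R \<Longrightarrow> finite (nbrs R v)"
proof -
  assume "finite R"
  then have "finite ((\<lambda>w. {v, w}) -` R)"
    by (intro finite_vimageI) (auto simp: inj_on_def doubleton_eq_iff)
  then show ?thesis by (simp add: nbrs_def vimage_def)
qed

section \<open>Drift of the tracked quantities\<close>

text \<open>Both quantities equal \<open>1\<close> on average if free sets of a given size are uniformly random and
  independent.\<close>

definition share :: "nat \<Rightarrow> color set \<Rightarrow> color \<Rightarrow> real" where
  "share g S c = (if c \<in> S then real g / real (card S) else 0)"

definition overlap :: "nat \<Rightarrow> color set \<Rightarrow> color set \<Rightarrow> real" where
  "overlap g S T = real g * real (card (S \<inter> T)) / (real (card S) * real (card T))"

lemma overlap_commute: "overlap g S T = overlap g T S"
  by (simp add: overlap_def Int_commute mult.commute)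

lemma overlap_eq_mean_share: "finite T \<Longrightarrow> overlap g S T = mean T (share g S)"
proof -
  assume "finite T"
  then have "(\<Sum>c\<in>T. share g S c) = real (card (S \<inter> T)) * (real g / real (card S))"
    unfolding share_def by (simp add: sum.If_cases Int_commute Int_def)
  then show ?thesis by (simp add: overlap_def mean_def)
qed

text \<open>The index \<open>None\<close> carries the constant weight 1. The remaining degree
  thereby becomes one more load, with the same target as the loads of the colors, and every estimate
  covers both at once.\<close>

definition weight :: "nat \<Rightarrow> (nat \<Rightarrow> color set) \<Rightarrow> color option \<Rightarrow> nat \<Rightarrow> real" where
  "weight g F x w = (case x of None \<Rightarrow> 1 | Some c \<Rightarrow> share g (F w) c)"

definition load :: "nat \<Rightarrow> (nat \<Rightarrow> color set) \<Rightarrow> edge set \<Rightarrow> nat \<Rightarrow> color option \<Rightarrow> real" where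
  "load g F R v x = (\<Sum>w\<in>nbrs R v. weight g F x w)"

definition use_color :: "edge \<Rightarrow> color \<Rightarrow> (nat \<Rightarrow> color set) \<Rightarrow> nat \<Rightarrow> color set" where
  "use_color e c F v = (if v \<in> e then F v - {c} else F v)"

text \<open>The factor \<open>{..<g}\<close> decides the case of the null edge: an intersection over
  the empty set is \<open>UNIV\<close>, and cutting it down leaves the whole palette.\<close>

definition admissible :: "nat \<Rightarrow> (nat \<Rightarrow> color set) \<Rightarrow> edge \<Rightarrow> color set" where
  "admissible g F e = {..<g} \<inter> (\<Inter>v\<in>e. F v)"

text \<open>Here \<open>R\<close> is the set of edges still to come, and \<open>\<theta> v\<close> is the expected degree of \<open>v\<close>
  in \<open>R\<close> divided by \<open>\<Delta>\<close>.\<close>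

locale tracked_state =
  fixes \<epsilon> B :: real and \<Delta> g :: nat and V :: "nat set"
    and F :: "nat \<Rightarrow> color set" and R :: "edge set" and \<theta> :: "nat \<Rightarrow> real"
  assumes eps: "0 < \<epsilon>" "\<epsilon> < 1"
    and eps_Delta: "2 \<le> \<epsilon> * real \<Delta>"
    and g_le: "g \<le> 2 * \<Delta>"
    and B: "B \<le> 1 / 2" "1 \<le> B * real \<Delta>"
    and finite_R: "finite R"
    and R_edge: "\<And>e. e \<in> R \<Longrightarrow> e \<subseteq> V \<and> card e = 2"
    and degree_le: "\<And>v. degree R v \<le> \<Delta>"
    and F_sub: "\<And>v. F v \<subseteq> {..<g}"
    and F_card: "\<And>v. \<epsilon> * real \<Delta> \<le> real (card (F v))"
    and overlap_near: "\<And>u v. u \<in> V \<Longrightarrow> v \<in> V \<Longrightarrow> u \<noteq> v \<Longrightarrow> \<bar>overlap g (F u) (F v) - 1\<bar> \<le> B"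
    and load_near: "\<And>v x. v \<in> V \<Longrightarrow> x \<in> insert None (Some ` {..<g}) \<Longrightarrow>
      \<bar>load g F R v x / real \<Delta> - \<theta> v\<bar> \<le> B"
begin

lemma Delta_pos: "0 < real \<Delta>"
  using eps_Delta by (cases "\<Delta> = 0") auto

lemma finite_F: "finite (F v)"
  using F_sub by (rule finite_subset) simp

lemma card_F_ge2: "2 \<le> real (card (F v))"
  using eps_Delta F_card by (rule order_trans)

lemma card_F_le: "card (F v) \<le> g"
  using card_mono[OF _ F_sub] by simp

lemma g_pos: "0 < real g"
  using card_F_ge2[of 0] card_F_le[of 0] by linarith

lemma card_sq_ge: "\<epsilon>\<^sup>2 * (real \<Delta>)\<^sup>2 \<le> real (card (F u)) * real (card (F v))"
  using mult_mono[OF F_card[of u] F_card[of v]] eps Delta_pos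
  by (simp add: power2_eq_square mult_ac)

text \<open>With f the size of \<open>F w\<close>, the left side is g/(f-1) - g/f, the rise of the
  share of a color that survives the loss of another one. The bound combines f-1 \<ge> f/2 with
  \<epsilon>\<Delta> \<le> f and g \<le> 2\<Delta>.\<close>

lemma slope_le: "real g / (real (card (F w)) * (real (card (F w)) - 1)) \<le> 4 / (\<epsilon>\<^sup>2 * real \<Delta>)"
proof -
  define f where "f = real (card (F w))"
  have f: "2 \<le> f" "\<epsilon>\<^sup>2 * (real \<Delta>)\<^sup>2 \<le> f * f"
    using card_F_ge2 card_sq_ge[of w w] by (auto simp: f_def)
  have "f * f \<le> 2 * (f * (f - 1))" using f(1) by (simp add: algebra_simps)
  then have "\<epsilon>\<^sup>2 * (real \<Delta>)\<^sup>2 / 2 \<le> f * (f - 1)" using f(2) by simp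
  then have "real g / (f * (f - 1)) \<le> 2 * real \<Delta> / (\<epsilon>\<^sup>2 * (real \<Delta>)\<^sup>2 / 2)"
    using g_le eps Delta_pos f(1) by (intro frac_le) auto
  also have "\<dots> = 4 / (\<epsilon>\<^sup>2 * real \<Delta>)"
    using eps Delta_pos by (simp add: field_simps power2_eq_square)
  finally show ?thesis by (simp add: f_def)
qed

lemma slope_nonneg: "0 \<le> real g / (real (card (F w)) * (real (card (F w)) - 1))"
  using card_F_ge2[of w] by simp

lemma ratio_le: "real g / real (card (F w)) \<le> 2 / \<epsilon>"
proof -
  have "real g / real (card (F w)) \<le> 2 * real \<Delta> / (\<epsilon> * real \<Delta>)"
    using g_le F_card[of w] eps Delta_pos by (intro frac_le) auto
  then show ?thesis using eps Delta_pos by simp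
qed

lemma share_bounds: "0 \<le> share g (F w) c" "share g (F w) c \<le> 2 / \<epsilon>"
  using ratio_le[of w] eps by (auto simp: share_def)

lemma weight_bounds: "0 \<le> weight g F x w" "weight g F x w \<le> 2 / \<epsilon>"
  using share_bounds eps by (auto simp: weight_def split: option.split)

lemma pair_in_V: "{u, w} \<in> R \<Longrightarrow> u \<in> V \<and> w \<in> V \<and> u \<noteq> w"
  using R_edge[of "{u, w}"] by auto

lemma overlap_ge: "u \<in> V \<Longrightarrow> v \<in> V \<Longrightarrow> u \<noteq> v \<Longrightarrow> 1 / 2 \<le> overlap g (F u) (F v)"
  using overlap_near[of u v] B by linarith

text \<open>An overlap of at least 1/2 means that the intersection has at least half of the size |F
  u| |F v| / g expected of independent sets, and this is at least (\<epsilon>\<Delta>)^2 /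
  (4\<Delta>).\<close>

lemma card_Int_ge:
  assumes "u \<in> V" "v \<in> V" "u \<noteq> v"
  shows "\<epsilon>\<^sup>2 * real \<Delta> / 4 \<le> real (card (F u \<inter> F v))"
proof -
  have f: "0 < real (card (F u)) * real (card (F v))"
    using card_F_ge2[of u] card_F_ge2[of v] by simp
  have "real (card (F u)) * real (card (F v)) / 2 \<le> real g * real (card (F u \<inter> F v))"
    using overlap_ge[OF assms] f by (simp add: overlap_def field_simps)
  also have "\<dots> \<le> (2 * real \<Delta>) * real (card (F u \<inter> F v))"
    using g_le by (intro mult_right_mono) auto
  finally have "\<epsilon>\<^sup>2 * (real \<Delta>)\<^sup>2 \<le> 4 * real \<Delta> * real (card (F u \<inter> F v))"
    using card_sq_ge[of u v] by simp
  then show ?thesis using Delta_pos by (simp add: power2_eq_square field_simps)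
qed

lemma admissible_pair: "admissible g F {u, w} = F u \<inter> F w"
  using F_sub by (auto simp: admissible_def)

lemma finite_admissible: "finite (admissible g F e)"
  by (simp add: admissible_def)

lemma card_admissible_ge: "{u, w} \<in> R \<Longrightarrow> \<epsilon>\<^sup>2 * real \<Delta> / 4 \<le> real (card (F u \<inter> F w))"
  using card_Int_ge pair_in_V by blast

lemma card_admissible_pos: "{u, w} \<in> R \<Longrightarrow> 0 < real (card (F u \<inter> F w))"
  using card_admissible_ge[of u w] eps Delta_pos by (smt (verit) divide_pos_pos mult_pos_pos zero_less_power)

lemma admissible_nonempty: 
  assumes "e \<in> R" shows "admissible g F e \<noteq> {}"
proof -
  obtain u w where "e = {u, w}" using R_edge[OF assms] by (auto simp: card_2_iff)
  then show ?thesis using card_admissible_pos[of u w] assms by (auto simp: admissible_pair)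
qed

section \<open>Effect of one colored edge on the share of a color\<close>

lemma share_change:
  assumes c: "c \<in> F w" and d: "d \<in> F w"
  shows "share g (F w - {d}) c - share g (F w) c =
    real g / (real (card (F w)) * (real (card (F w)) - 1)) * (1 - (if c = d then real (card (F w)) else 0))"
proof -
  define f where "f = real (card (F w))"
  have f: "2 \<le> f" using card_F_ge2 by (simp add: f_def)
  have 1: "real (card (F w - {d})) = f - 1"
    using d finite_F[of w] f unfolding f_def by (simp add: card_Diff_singleton of_nat_diff)
  show ?thesis
    unfolding share_def 1 f_def[symmetric] using c f by (simp add: field_simps)
qed

lemma abs_share_change_le:
  assumes d: "d \<in> F w"
  shows "\<bar>share g (F w - {d}) c - share g (F w) c\<bar> \<le> 2 / \<epsilon>"
proof (cases "c \<in> F w")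
  case True
  define f where "f = real (card (F w))"
  have f: "2 \<le> f" using card_F_ge2 by (simp add: f_def)
  have "\<bar>1 - (if c = d then f else 0)\<bar> \<le> f - 1" using f by auto
  then have "\<bar>share g (F w - {d}) c - share g (F w) c\<bar> \<le> real g / (f * (f - 1)) * (f - 1)"
    unfolding share_change[OF True d] f_def[symmetric] abs_mult using f
    by (intro mult_mono) auto
  also have "\<dots> = real g / f" using f by simp
  also have "\<dots> \<le> 2 / \<epsilon>" using ratio_le by (simp add: f_def)
  finally show ?thesis .
next
  case False
  then show ?thesis using eps by (simp add: share_def)
qed

text \<open>The new color d is uniform on \<open>F w \<inter> F w'\<close>. The loss term in
  \<open>share_change\<close> is |F w| when d = c, so its mean is |F w| / |F w \<inter> F w'| if c
  is also free at w' and 0 otherwise, which is precisely the quotient of share and overlap.\<close>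

lemma mean_share_change:
  assumes e: "{w, w'} \<in> R" and c: "c \<in> F w"
  shows "mean (admissible g F {w, w'}) (\<lambda>d. share g (F w - {d}) c - share g (F w) c) =
    real g / (real (card (F w)) * (real (card (F w)) - 1)) *
      (1 - share g (F w') c / overlap g (F w) (F w'))"
proof -
  define f where "f = real (card (F w))"
  define s where "s = real g / (f * (f - 1))"
  define A where "A = F w \<inter> F w'"
  have A: "finite A" "0 < real (card A)" "A \<subseteq> F w"
    using finite_F card_admissible_pos[OF e] by (auto simp: A_def)
  have f: "2 \<le> f" "2 \<le> real (card (F w'))" using card_F_ge2 by (auto simp: f_def)
  have "mean (admissible g F {w, w'}) (\<lambda>d. share g (F w - {d}) c - share g (F w) c) =
      mean A (\<lambda>d. s * (1 - (if c = d then f else 0)))"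
    unfolding admissible_pair A_def[symmetric]
    using A(3) share_change[OF c] by (intro mean_cong) (auto simp: s_def f_def)
  also have "\<dots> = s * mean A (\<lambda>d. 1 - (if c = d then f else 0))"
    by (rule mean_mult_left)
  also have "mean A (\<lambda>d. 1 - (if c = d then f else 0)) = 1 - (if c \<in> A then f else 0) / real (card A)"
    using A by (auto simp: mean_def sum_subtractf diff_divide_distrib)
  also have "(if c \<in> A then f else 0) / real (card A) = share g (F w') c / overlap g (F w) (F w')"
    using c f A g_pos by (simp add: share_def overlap_def A_def f_def)
  finally show ?thesis by (simp add: s_def f_def)
qed

lemma abs_mean_share_change_le:
  assumes e: "{w, w'} \<in> R"
  shows "\<bar>mean (admissible g F {w, w'}) (\<lambda>d. share g (F w - {d}) c - share g (F w) c)\<bar>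
    \<le> 20 / (\<epsilon> ^ 3 * real \<Delta>)"
proof (cases "c \<in> F w")
  case True
  have V: "w \<in> V" "w' \<in> V" "w \<noteq> w'" using pair_in_V[OF e] by auto
  have "share g (F w') c / overlap g (F w) (F w') \<le> (2 / \<epsilon>) / (1 / 2)"
    using share_bounds overlap_ge[OF V] eps by (intro frac_le) auto
  moreover have "0 \<le> share g (F w') c / overlap g (F w) (F w')"
    using share_bounds overlap_ge[OF V] by simp
  moreover have "4 / \<epsilon> + 1 \<le> 5 / \<epsilon>" using eps by (simp add: field_simps)
  ultimately have 1: "\<bar>1 - share g (F w') c / overlap g (F w) (F w')\<bar> \<le> 5 / \<epsilon>"
    using eps by (simp add: abs_le_iff)
  have "\<bar>mean (admissible g F {w, w'}) (\<lambda>d. share g (F w - {d}) c - share g (F w) c)\<bar>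
      \<le> 4 / (\<epsilon>\<^sup>2 * real \<Delta>) * (5 / \<epsilon>)"
    unfolding mean_share_change[OF e True] abs_mult abs_of_nonneg[OF slope_nonneg]
    using slope_le[of w] 1 eps by (intro mult_mono) auto
  also have "\<dots> = 20 / (\<epsilon> ^ 3 * real \<Delta>)" by (simp add: power3_eq_cube power2_eq_square)
  finally show ?thesis .
next
  case False
  then show ?thesis using eps by (simp add: share_def mean_def)
qed

text \<open>A share can drop by as much as 2/\<epsilon>, but only if d is c itself, which has
  probability at most 4 / (\<epsilon>^2 \<Delta>); in all other cases it moves by the slope alone.
  Hence the mean is of order 1/\<Delta>, although the largest change is not.\<close>

lemma mean_abs_share_change_le:
  assumes e: "{w, w'} \<in> R"
  shows "mean (admissible g F {w, w'}) (\<lambda>d. \<bar>share g (F w - {d}) c - share g (F w) c\<bar>)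
    \<le> 12 / (\<epsilon> ^ 3 * real \<Delta>)"
proof (cases "c \<in> F w")
  case True
  define f where "f = real (card (F w))"
  define s where "s = real g / (f * (f - 1))"
  define A where "A = F w \<inter> F w'"
  have A: "finite A" "0 < real (card A)" "A \<subseteq> F w" "\<epsilon>\<^sup>2 * real \<Delta> / 4 \<le> real (card A)"
    using finite_F card_admissible_pos[OF e] card_admissible_ge[OF e] by (auto simp: A_def)
  have f: "2 \<le> f" using card_F_ge2 by (auto simp: f_def)
  have s: "0 \<le> s" "s \<le> 4 / (\<epsilon>\<^sup>2 * real \<Delta>)"
    using slope_le[of w] slope_nonneg[of w] by (auto simp: s_def f_def)
  have "mean (admissible g F {w, w'}) (\<lambda>d. \<bar>share g (F w - {d}) c - share g (F w) c\<bar>)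
      \<le> mean A (\<lambda>d. s * (1 + (if c = d then f - 1 else 0)))"
    unfolding admissible_pair A_def[symmetric]
  proof (rule mean_mono)
    fix d assume "d \<in> A"
    then have "d \<in> F w" using A by auto
    from share_change[OF True this]
    have "\<bar>share g (F w - {d}) c - share g (F w) c\<bar> = \<bar>s\<bar> * \<bar>1 - (if c = d then f else 0)\<bar>"
      by (simp add: s_def f_def abs_mult)
    also have "\<dots> \<le> s * (1 + (if c = d then f - 1 else 0))"
      using s f by (intro mult_mono) auto
    finally show "\<bar>share g (F w - {d}) c - share g (F w) c\<bar> \<le> s * (1 + (if c = d then f - 1 else 0))" .
  qed
  also have "\<dots> = s * (1 + (if c \<in> A then f - 1 else 0) / real (card A))"
    unfolding mean_mult_left using A by (auto simp: mean_def sum.distrib add_divide_distrib)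
  also have "\<dots> \<le> s * (1 + (f - 1) / (\<epsilon>\<^sup>2 * real \<Delta> / 4))"
    using s f A eps Delta_pos by (intro mult_left_mono add_left_mono frac_le) auto
  also have "\<dots> = s + (real g / f) * (4 / (\<epsilon>\<^sup>2 * real \<Delta>))"
    using f eps Delta_pos unfolding s_def by (simp add: field_simps)
  also have "\<dots> \<le> 4 / (\<epsilon>\<^sup>2 * real \<Delta>) + (2 / \<epsilon>) * (4 / (\<epsilon>\<^sup>2 * real \<Delta>))"
    using s ratio_le[of w] eps Delta_pos by (intro add_mono mult_right_mono) (auto simp: f_def)
  also have "\<dots> \<le> 12 / (\<epsilon> ^ 3 * real \<Delta>)"
    using eps Delta_pos by (simp add: field_simps power3_eq_cube power2_eq_square)
  finally show ?thesis .
next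
  case False
  then show ?thesis using eps by (simp add: share_def mean_def)
qed

end

text \<open>\<open>{u, v}\<close> is the only edge that both incidence sums count; the last summand
  removes these two contributions and puts the special value in their place. For loads the special
  value is the removal of the edge, for overlaps the joint change at both ends.\<close>

lemma sum_two_vertices:
  fixes j p q :: "edge \<Rightarrow> real"
  assumes "finite R" "\<And>e. e \<in> R \<Longrightarrow> card e = 2" "u \<noteq> v"
  shows "(\<Sum>e\<in>R. if e = {u, v} then j e else if u \<in> e then p e else if v \<in> e then q e else 0) =
    (\<Sum>e\<in>{e \<in> R. u \<in> e}. p e) + (\<Sum>e\<in>{e \<in> R. v \<in> e}. q e)
    + (if {u, v} \<in> R then j {u, v} - p {u, v} - q {u, v} else 0)"
proof -
  have both: "e = {u, v}" if "e \<in> R" "u \<in> e" "v \<in> e" for e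
    using that assms(2)[OF that(1)] assms(3) by (auto simp: card_2_iff)
  have "(\<Sum>e\<in>R. if e = {u, v} then j e else if u \<in> e then p e else if v \<in> e then q e else 0) =
     (\<Sum>e\<in>R. (if u \<in> e then p e else 0) + (if v \<in> e then q e else 0)
       + (if e = {u, v} then j e - p e - q e else 0))"
  proof (rule sum.cong[OF refl])
    fix e assume "e \<in> R"
    then have "e = {u, v} \<or> e \<noteq> {u, v} \<and> \<not> (u \<in> e \<and> v \<in> e)"
      using both by blast
    then show "(if e = {u, v} then j e else if u \<in> e then p e else if v \<in> e then q e else 0) =
      (if u \<in> e then p e else 0) + (if v \<in> e then q e else 0)
       + (if e = {u, v} then j e - p e - q e else 0)"
      by (elim disjE) auto
  qed
  also have "\<dots> = (\<Sum>e\<in>R. if u \<in> e then p e else 0) + (\<Sum>e\<in>R. if v \<in> e then q e else 0)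
       + (\<Sum>e\<in>R. if e = {u, v} then j e - p e - q e else 0)"
    by (simp add: sum.distrib)
  also have "(\<Sum>e\<in>R. if u \<in> e then p e else 0) = (\<Sum>e\<in>{e \<in> R. u \<in> e}. p e)"
    using assms(1) by (rule sum.inter_filter[symmetric])
  also have "(\<Sum>e\<in>R. if v \<in> e then q e else 0) = (\<Sum>e\<in>{e \<in> R. v \<in> e}. q e)"
    using assms(1) by (rule sum.inter_filter[symmetric])
  finally show ?thesis using assms(1) by simp
qed

section \<open>Summed drifts of the shares and of the loads\<close>

context tracked_state
begin

lemma card_R: "e \<in> R \<Longrightarrow> card e = 2"
  using R_edge by blast

lemma sum_incident_R: "(\<Sum>e\<in>{e \<in> R. v \<in> e}. f e) = (\<Sum>w\<in>nbrs R v. f {v, w})"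
  by (rule sum_incident) (rule card_R)

lemmas sum_two_vertices_R = sum_two_vertices[OF finite_R card_R, simplified]

lemma card_nbrs_le: "card (nbrs R v) \<le> \<Delta>"
  using card_nbrs[of R v] R_edge degree_le[of v] by simp

lemma sum_nbrs_le:
  assumes "\<And>w. w \<in> nbrs R v \<Longrightarrow> f w \<le> k" "0 \<le> k"
  shows "sum f (nbrs R v) \<le> real \<Delta> * k"
proof -
  have "sum f (nbrs R v) \<le> real (card (nbrs R v)) * k"
    using assms(1) by (rule sum_bounded_above)
  also have "\<dots> \<le> real \<Delta> * k"
    using card_nbrs_le assms(2) by (intro mult_right_mono) auto
  finally show ?thesis .
qed

lemma sum_incident_le:
  assumes "\<And>e. e \<in> R \<Longrightarrow> v \<in> e \<Longrightarrow> f e \<le> k" "0 \<le> k"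
  shows "(\<Sum>e\<in>{e \<in> R. v \<in> e}. f e) \<le> real \<Delta> * k"
proof -
  have "f {v, w} \<le> k" if "w \<in> nbrs R v" for w
    using that assms(1)[of "{v, w}"] by (simp add: nbrs_def)
  then show ?thesis
    using sum_nbrs_le[of v "\<lambda>w. f {v, w}" k] assms(2) by (simp add: sum_incident_R)
qed

lemma nbrs_in_V: "w \<in> nbrs R v \<Longrightarrow> w \<in> V \<and> v \<in> V \<and> v \<noteq> w"
  using pair_in_V[of v w] by (simp add: nbrs_def)

lemma B_nonneg: "0 \<le> B"
  using B(2) Delta_pos by (smt (verit) mult_nonneg_nonneg mult_nonpos_nonneg)

text \<open>Effects of a single edge are of order 1/\<Delta>; this inequality lets them be absorbed
  into the error \<open>B\<close>.\<close>

lemma inverse_Delta_le: "1 / real \<Delta> \<le> B"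
  using B(2) Delta_pos by (simp add: field_simps)

definition share_step :: "color \<Rightarrow> nat \<Rightarrow> color \<Rightarrow> real" where
  "share_step c w d = share g (F w - {d}) c - share g (F w) c"

text \<open>Here the system closes. The sum is the slope, of order 1/\<Delta>, times the sum of 1 -
  y/z over the remaining neighbors, with y a share and z an overlap. Write 1 - y/z = (1 - y) + (y -
  y/z). The first part sums to the difference of the loads for \<open>None\<close> and
  \<open>Some c\<close>, whose common target cancels; each term of the second part is small because
  z is near 1.\<close>

lemma share_drift:
  assumes w: "w \<in> V"
  shows "\<bar>\<Sum>e\<in>{e \<in> R. w \<in> e}. mean (admissible g F e) (share_step c w)\<bar> \<le> 24 * B / \<epsilon> ^ 3"
proof (cases "c \<in> F w")
  case True
  then have c: "c \<in> {..<g}" using F_sub by auto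
  define s where "s = real g / (real (card (F w)) * (real (card (F w)) - 1))"
  define y where "y = (\<lambda>w'. share g (F w') c)"
  define z where "z = (\<lambda>w'. overlap g (F w) (F w'))"
  have "(\<Sum>e\<in>{e \<in> R. w \<in> e}. mean (admissible g F e) (share_step c w)) =
      (\<Sum>w'\<in>nbrs R w. s * (1 - y w' / z w'))"
    unfolding sum_incident_R share_step_def[abs_def]
    by (intro sum.cong refl) (simp add: nbrs_def s_def y_def z_def mean_share_change[OF _ True])
  also have "\<dots> = s * (\<Sum>w'\<in>nbrs R w. 1 - y w' / z w')" by (simp add: sum_distrib_left)
  finally have eq: "(\<Sum>e\<in>{e \<in> R. w \<in> e}. mean (admissible g F e) (share_step c w)) =
      s * (\<Sum>w'\<in>nbrs R w. 1 - y w' / z w')" .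
  have "\<bar>load g F R w None / real \<Delta> - load g F R w (Some c) / real \<Delta>\<bar> \<le> 2 * B"
    using load_near[OF w, of None] load_near[OF w, of "Some c"] c by force
  then have "\<bar>(load g F R w None - load g F R w (Some c)) / real \<Delta>\<bar> \<le> 2 * B"
    by (simp add: diff_divide_distrib)
  then have "\<bar>load g F R w None - load g F R w (Some c)\<bar> \<le> 2 * B * real \<Delta>"
    using Delta_pos by (simp add: abs_divide field_simps)
  moreover have "load g F R w None - load g F R w (Some c) = (\<Sum>w'\<in>nbrs R w. 1 - y w')"
    by (simp add: load_def weight_def y_def sum_subtractf)
  ultimately have 1: "\<bar>\<Sum>w'\<in>nbrs R w. 1 - y w'\<bar> \<le> 2 * B * real \<Delta>" by simp
  have "\<bar>\<Sum>w'\<in>nbrs R w. y w' - y w' / z w'\<bar> \<le> (\<Sum>w'\<in>nbrs R w. \<bar>y w' - y w' / z w'\<bar>)"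
    by (rule sum_abs)
  also have "\<dots> \<le> real \<Delta> * (2 / \<epsilon> * (2 * B))"
  proof (rule sum_nbrs_le)
    fix w' assume "w' \<in> nbrs R w"
    then have V: "w' \<in> V" "w \<noteq> w'" using nbrs_in_V by auto
    have z: "1 / 2 \<le> z w'" "\<bar>z w' - 1\<bar> \<le> B"
      using overlap_ge[OF w V] overlap_near[OF w V] by (auto simp: z_def)
    have "y w' - y w' / z w' = y w' * ((z w' - 1) / z w')"
      using z(1) by (simp add: field_simps)
    then have "\<bar>y w' - y w' / z w'\<bar> = y w' * (\<bar>z w' - 1\<bar> / z w')"
      using z(1) share_bounds(1)[of w' c] by (simp add: abs_mult abs_divide y_def)
    also have "\<dots> \<le> 2 / \<epsilon> * (B / (1 / 2))"
      using z share_bounds[of w' c] eps unfolding y_def by (intro mult_mono frac_le) auto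
    finally show "\<bar>y w' - y w' / z w'\<bar> \<le> 2 / \<epsilon> * (2 * B)" by simp
  next
    show "0 \<le> 2 / \<epsilon> * (2 * B)" using eps B_nonneg by simp
  qed
  finally have 2: "\<bar>\<Sum>w'\<in>nbrs R w. y w' - y w' / z w'\<bar> \<le> real \<Delta> * (4 * B / \<epsilon>)" by simp
  have "(\<Sum>w'\<in>nbrs R w. 1 - y w' / z w') =
      (\<Sum>w'\<in>nbrs R w. 1 - y w') + (\<Sum>w'\<in>nbrs R w. y w' - y w' / z w')"
    by (simp add: sum.distrib[symmetric])
  then have "\<bar>\<Sum>w'\<in>nbrs R w. 1 - y w' / z w'\<bar> \<le> real \<Delta> * B * (2 + 4 / \<epsilon>)"
    using 1 2 by (simp add: algebra_simps)
  also have "\<dots> \<le> real \<Delta> * B * (6 / \<epsilon>)"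
    using eps B_nonneg by (intro mult_left_mono) (auto simp: field_simps)
  finally have 3: "\<bar>\<Sum>w'\<in>nbrs R w. 1 - y w' / z w'\<bar> \<le> real \<Delta> * B * (6 / \<epsilon>)" .
  have "\<bar>s * (\<Sum>w'\<in>nbrs R w. 1 - y w' / z w')\<bar> \<le> 4 / (\<epsilon>\<^sup>2 * real \<Delta>) * (real \<Delta> * B * (6 / \<epsilon>))"
    using 3 slope_le[of w] slope_nonneg[of w] eps
    unfolding abs_mult s_def abs_of_nonneg[OF slope_nonneg] by (intro mult_mono) auto
  also have "\<dots> = 24 * B / \<epsilon> ^ 3"
    using Delta_pos eps by (simp add: field_simps power3_eq_cube power2_eq_square)
  finally show ?thesis unfolding eq .
next
  case False
  then have "share_step c w d = 0" for d by (simp add: share_step_def share_def)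
  then show ?thesis using eps B_nonneg by (simp add: mean_def)
qed

definition load_step :: "nat \<Rightarrow> color option \<Rightarrow> edge \<Rightarrow> color \<Rightarrow> real" where
  "load_step v x e d =
     (load g (use_color e d F) (R - {e}) v x - load g F R v x) / real \<Delta>"

definition weight_step :: "color option \<Rightarrow> nat \<Rightarrow> color \<Rightarrow> real" where
  "weight_step x w d = (case x of None \<Rightarrow> 0 | Some c \<Rightarrow> share_step c w d)"

text \<open>The last conditional is redundant; it gives the term the shape of \<open>sum_two_vertices\<close>.\<close>

definition term_step :: "nat \<Rightarrow> color option \<Rightarrow> nat \<Rightarrow> edge \<Rightarrow> color \<Rightarrow> real" where
  "term_step v x w e d = (if e = {w, v} then - weight g F x w
     else if w \<in> e then weight_step x w d else if v \<in> e then 0 else 0)"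

text \<open>The load splits into one term per neighbor w: it disappears when the edge from w to v is
  played, and changes its weight when w receives another edge. An edge at v that avoids w leaves it
  alone.\<close>

lemma load_step_eq:
  "load_step v x e d = (\<Sum>w\<in>nbrs R v. term_step v x w e d) / real \<Delta>"
proof -
  have fin: "finite (nbrs R v)" by (rule finite_nbrs[OF finite_R])
  have nb: "nbrs (R - {e}) v = {w \<in> nbrs R v. e \<noteq> {w, v}}"
    by (auto simp: nbrs_def insert_commute)
  have "load g (use_color e d F) (R - {e}) v x =
      (\<Sum>w\<in>nbrs R v. if e \<noteq> {w, v} then weight g (use_color e d F) x w else 0)"
    unfolding load_def nb by (rule sum.inter_filter[OF fin])
  then have "load g (use_color e d F) (R - {e}) v x - load g F R v x =
      (\<Sum>w\<in>nbrs R v. (if e \<noteq> {w, v} then weight g (use_color e d F) x w else 0) - weight g F x w)"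
    by (simp add: load_def sum_subtractf)
  also have "\<dots> = (\<Sum>w\<in>nbrs R v. term_step v x w e d)"
    by (intro sum.cong)
      (auto simp: term_step_def weight_step_def share_step_def weight_def use_color_def split: option.split)
  finally show ?thesis by (simp add: load_step_def)
qed

lemma abs_mean_weight_step_le:
  "{w, w'} \<in> R \<Longrightarrow> \<bar>mean (admissible g F {w, w'}) (weight_step x w)\<bar> \<le> 20 / (\<epsilon> ^ 3 * real \<Delta>)"
  using abs_mean_share_change_le[of w w'] eps
  by (cases x) (auto simp: weight_step_def[abs_def] share_step_def[abs_def] mean_def)

lemma mean_abs_weight_step_le:
  "{w, w'} \<in> R \<Longrightarrow>
    mean (admissible g F {w, w'}) (\<lambda>d. \<bar>weight_step x w d\<bar>) \<le> 12 / (\<epsilon> ^ 3 * real \<Delta>)"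
  using mean_abs_share_change_le[of w w'] eps
  by (cases x) (auto simp: weight_step_def[abs_def] share_step_def[abs_def] mean_def)

lemma weight_drift:
  assumes w: "w \<in> V"
  shows "\<bar>\<Sum>e\<in>{e \<in> R. w \<in> e}. mean (admissible g F e) (weight_step x w)\<bar> \<le> 24 * B / \<epsilon> ^ 3"
  using share_drift[OF w] eps B_nonneg
  by (cases x) (auto simp: weight_step_def[abs_def] mean_def)

lemma mean_term_step:
  "e \<in> R \<Longrightarrow> mean (admissible g F e) (term_step v x w e) =
    (if e = {w, v} then - weight g F x w else if w \<in> e then mean (admissible g F e) (weight_step x w)
     else if v \<in> e then 0 else 0)"
  using mean_const[OF finite_admissible admissible_nonempty, of e "- weight g F x w"]
  by (auto simp: term_step_def[abs_def] mean_def[of _ "\<lambda>_. 0"])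

text \<open>Each remaining edge \<open>{w, v}\<close> deletes its own weight, and these deletions
  sum to minus the load. Together with \<open>\<theta> v\<close> they leave minus the current
  deviation, at most \<open>B\<close> in absolute value. The remainder averages the share drifts at
  the neighbors.\<close>

lemma load_drift:
  assumes v: "v \<in> V" and x: "x \<in> insert None (Some ` {..<g})"
  shows "\<bar>(\<Sum>e\<in>R. mean (admissible g F e) (load_step v x e)) + \<theta> v\<bar> \<le> 100 * B / \<epsilon> ^ 3"
proof -
  \<comment> \<open>The edge \<open>{w, v}\<close> removes w from the sum instead of changing its
    weight, so its contribution is taken out of the drift at w.\<close>
  define r where "r = (\<lambda>w. (\<Sum>e\<in>{e \<in> R. w \<in> e}. mean (admissible g F e) (weight_step x w))
      - mean (admissible g F {w, v}) (weight_step x w))"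
  have inner: "(\<Sum>e\<in>R. mean (admissible g F e) (term_step v x w e)) = - weight g F x w + r w"
    if "w \<in> nbrs R v" for w
  proof -
    have wv: "w \<noteq> v" "{w, v} \<in> R" using that nbrs_in_V by (auto simp: nbrs_def insert_commute)
    have "(\<Sum>e\<in>R. mean (admissible g F e) (term_step v x w e)) =
       (\<Sum>e\<in>R. if e = {w, v} then - weight g F x w
          else if w \<in> e then mean (admissible g F e) (weight_step x w) else if v \<in> e then 0 else 0)"
      using mean_term_step by (rule sum.cong[OF refl])
    also have "\<dots> = - weight g F x w + r w"
      using sum_two_vertices_R[OF wv(1), of "\<lambda>_. - weight g F x w"
        "\<lambda>e. mean (admissible g F e) (weight_step x w)" "\<lambda>_. 0"] wv(2)
      by (simp add: r_def)
    finally show ?thesis .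
  qed
  have "(\<Sum>e\<in>R. mean (admissible g F e) (load_step v x e)) =
      (\<Sum>e\<in>R. \<Sum>w\<in>nbrs R v. mean (admissible g F e) (term_step v x w e)) / real \<Delta>"
    unfolding load_step_eq[abs_def] mean_sum[symmetric] by (simp add: mean_def sum_divide_distrib mult.commute)
  also have "(\<Sum>e\<in>R. \<Sum>w\<in>nbrs R v. mean (admissible g F e) (term_step v x w e)) =
      (\<Sum>w\<in>nbrs R v. \<Sum>e\<in>R. mean (admissible g F e) (term_step v x w e))"
    by (rule sum.swap)
  also have "\<dots> = (\<Sum>w\<in>nbrs R v. - weight g F x w + r w)"
    using inner by (intro sum.cong) auto
  also have "\<dots> = - load g F R v x + sum r (nbrs R v)"
    by (simp add: load_def sum_subtractf)
  finally have eq: "(\<Sum>e\<in>R. mean (admissible g F e) (load_step v x e)) + \<theta> v =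
      - (load g F R v x / real \<Delta> - \<theta> v) + sum r (nbrs R v) / real \<Delta>"
    by (simp add: field_simps diff_divide_distrib add_divide_distrib)
  have e3: "\<epsilon> ^ 3 \<le> 1" "0 < \<epsilon> ^ 3" using eps by (auto intro: power_le_one)
  have "\<bar>sum r (nbrs R v)\<bar> \<le> (\<Sum>w\<in>nbrs R v. \<bar>r w\<bar>)" by (rule sum_abs)
  also have "\<dots> \<le> real \<Delta> * (44 * B / \<epsilon> ^ 3)"
  proof (rule sum_nbrs_le)
    fix w assume w: "w \<in> nbrs R v"
    then have wv: "w \<in> V" "{w, v} \<in> R" using nbrs_in_V by (auto simp: nbrs_def insert_commute)
    have "20 / (\<epsilon> ^ 3 * real \<Delta>) = 20 / \<epsilon> ^ 3 * (1 / real \<Delta>)" by simp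
    also have "\<dots> \<le> 20 / \<epsilon> ^ 3 * B" using inverse_Delta_le e3 by (intro mult_left_mono) auto
    finally have "\<bar>r w\<bar> \<le> 24 * B / \<epsilon> ^ 3 + 20 / \<epsilon> ^ 3 * B"
      using weight_drift[OF wv(1), of x] abs_mean_weight_step_le[OF wv(2), of x] by (simp add: r_def)
    then show "\<bar>r w\<bar> \<le> 44 * B / \<epsilon> ^ 3" by (simp add: add_divide_distrib[symmetric])
  qed (use e3 B_nonneg in auto)
  finally have 1: "\<bar>sum r (nbrs R v) / real \<Delta>\<bar> \<le> 44 * B / \<epsilon> ^ 3"
    using Delta_pos by (simp add: abs_divide field_simps)
  have "B \<le> B / \<epsilon> ^ 3" using e3 B_nonneg by (simp add: field_simps mult_left_le)
  then have "\<bar>(\<Sum>e\<in>R. mean (admissible g F e) (load_step v x e)) + \<theta> v\<bar> \<le> B / \<epsilon> ^ 3 + 44 * B / \<epsilon> ^ 3"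
    unfolding eq using 1 load_near[OF v x] by linarith
  also have "\<dots> \<le> 100 * B / \<epsilon> ^ 3"
    using e3 B_nonneg by (simp add: add_divide_distrib[symmetric] divide_right_mono)
  finally show ?thesis .
qed

text \<open>Each of the at most \<Delta> neighbors w contributes a bounded amount: its weight once,
  when \<open>{w, v}\<close> is played, and O(1/\<Delta>) on average for each of the at most
  \<Delta> edges at w. The division by \<Delta> in \<open>load_step\<close> makes the total O(1).
  The constant is the one that \<open>overlap_variation\<close> gives.\<close>

lemma load_variation:
  "(\<Sum>e\<in>R. mean (admissible g F e) (\<lambda>d. \<bar>load_step v x e d\<bar>)) \<le> 24 / \<epsilon> ^ 3"
proof -
  have e3: "\<epsilon> ^ 3 \<le> 1" "0 < \<epsilon> ^ 3" using eps by (auto intro: power_le_one)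
  have inner: "(\<Sum>e\<in>R. mean (admissible g F e) (\<lambda>d. \<bar>term_step v x w e d\<bar>)) \<le> 2 / \<epsilon> + 12 / \<epsilon> ^ 3"
    if "w \<in> nbrs R v" for w
  proof -
    define p where "p = (\<lambda>e. mean (admissible g F e) (\<lambda>d. \<bar>weight_step x w d\<bar>))"
    have p_nonneg: "0 \<le> p e" for e by (simp add: p_def mean_def sum_nonneg)
    have wv: "w \<noteq> v" "{w, v} \<in> R" using that nbrs_in_V by (auto simp: nbrs_def insert_commute)
    have "(\<Sum>e\<in>R. mean (admissible g F e) (\<lambda>d. \<bar>term_step v x w e d\<bar>)) =
       (\<Sum>e\<in>R. if e = {w, v} then weight g F x w else if w \<in> e then p e else if v \<in> e then 0 else 0)"
      using mean_const[OF finite_admissible admissible_nonempty] weight_bounds(1)[of x w]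
      by (intro sum.cong) (auto simp: term_step_def[abs_def] mean_def[of _ "\<lambda>_. 0"] p_def)
    also have "\<dots> = (\<Sum>e\<in>{e \<in> R. w \<in> e}. p e) + weight g F x w - p {w, v}"
      using sum_two_vertices_R[OF wv(1), of "\<lambda>_. weight g F x w" p "\<lambda>_. 0"] wv(2)
      by simp
    also have "(\<Sum>e\<in>{e \<in> R. w \<in> e}. p e) = (\<Sum>w'\<in>nbrs R w. p {w, w'})"
      by (rule sum_incident_R)
    also have "(\<Sum>w'\<in>nbrs R w. p {w, w'}) \<le> real \<Delta> * (12 / (\<epsilon> ^ 3 * real \<Delta>))"
      using mean_abs_weight_step_le[of w _ x] eps by (intro sum_nbrs_le) (auto simp: p_def nbrs_def)
    finally have "(\<Sum>e\<in>R. mean (admissible g F e) (\<lambda>d. \<bar>term_step v x w e d\<bar>))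
        \<le> real \<Delta> * (12 / (\<epsilon> ^ 3 * real \<Delta>)) + 2 / \<epsilon>"
      using weight_bounds(2)[of x w] p_nonneg[of "{w, v}"] by simp
    then show ?thesis using Delta_pos by simp
  qed
  have "(\<Sum>e\<in>R. mean (admissible g F e) (\<lambda>d. \<bar>load_step v x e d\<bar>)) \<le>
      (\<Sum>e\<in>R. mean (admissible g F e) (\<lambda>d. \<Sum>w\<in>nbrs R v. \<bar>term_step v x w e d\<bar>)) / real \<Delta>"
    unfolding sum_divide_distrib
  proof (rule sum_mono)
    fix e assume "e \<in> R"
    have "mean (admissible g F e) (\<lambda>d. \<bar>load_step v x e d\<bar>) \<le>
        mean (admissible g F e) (\<lambda>d. (1 / real \<Delta>) * (\<Sum>w\<in>nbrs R v. \<bar>term_step v x w e d\<bar>))"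
      by (intro mean_mono) (simp add: load_step_eq abs_divide divide_right_mono)
    then show "mean (admissible g F e) (\<lambda>d. \<bar>load_step v x e d\<bar>) \<le>
        mean (admissible g F e) (\<lambda>d. \<Sum>w\<in>nbrs R v. \<bar>term_step v x w e d\<bar>) / real \<Delta>"
      unfolding mean_mult_left by simp
  qed
  also have "(\<Sum>e\<in>R. mean (admissible g F e) (\<lambda>d. \<Sum>w\<in>nbrs R v. \<bar>term_step v x w e d\<bar>)) =
      (\<Sum>w\<in>nbrs R v. \<Sum>e\<in>R. mean (admissible g F e) (\<lambda>d. \<bar>term_step v x w e d\<bar>))"
    unfolding mean_sum by (rule sum.swap)
  also have "\<dots> \<le> real \<Delta> * (2 / \<epsilon> + 12 / \<epsilon> ^ 3)"
    using inner eps by (intro sum_nbrs_le) auto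
  finally have "(\<Sum>e\<in>R. mean (admissible g F e) (\<lambda>d. \<bar>load_step v x e d\<bar>)) \<le> 2 / \<epsilon> + 12 / \<epsilon> ^ 3"
    using Delta_pos by (simp add: divide_right_mono)
  also have "2 / \<epsilon> \<le> 2 / \<epsilon> ^ 3"
    using eps e3 power_decreasing[of 1 3 \<epsilon>] by (intro divide_left_mono) auto
  also have "2 / \<epsilon> ^ 3 + 12 / \<epsilon> ^ 3 \<le> 24 / \<epsilon> ^ 3"
    using e3 by (simp add: add_divide_distrib[symmetric] divide_right_mono)
  finally show ?thesis by simp
qed

text \<open>An edge has two ends, so at most two summands of the load change, each by at most
  2/\<epsilon>. The constant 12 and the power of \<epsilon> are those of the overlaps, to have one
  bound for both families.\<close>

lemma abs_load_step_le:
  assumes e: "e \<in> R" and d: "d \<in> admissible g F e"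
  shows "\<bar>load_step v x e d\<bar> \<le> 12 / (\<epsilon>\<^sup>2 * real \<Delta>)"
proof -
  obtain a b where ab: "e = {a, b}" using card_R[OF e] by (auto simp: card_2_iff)
  have ws: "\<bar>weight_step x w d\<bar> \<le> 2 / \<epsilon>" if "w \<in> e" for w
  proof -
    have "d \<in> F w" using d that by (auto simp: admissible_def)
    then show ?thesis using abs_share_change_le[of d w] eps
      by (auto simp: weight_step_def share_step_def split: option.split)
  qed
  have t: "\<bar>term_step v x w e d\<bar> \<le> (if w \<in> e then 2 / \<epsilon> else 0)" for w
    using ws[of w] weight_bounds[of x w] by (auto simp: term_step_def)
  have "\<bar>\<Sum>w\<in>nbrs R v. term_step v x w e d\<bar> \<le> (\<Sum>w\<in>nbrs R v. if w \<in> e then 2 / \<epsilon> else 0)"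
    using t by (intro order_trans[OF sum_abs] sum_mono)
  also have "\<dots> = (\<Sum>w\<in>{w \<in> nbrs R v. w \<in> e}. 2 / \<epsilon>)"
    by (rule sum.inter_filter[symmetric]) (rule finite_nbrs[OF finite_R])
  also have "\<dots> \<le> real (card e) * (2 / \<epsilon>)"
  proof -
    have "card {w \<in> nbrs R v. w \<in> e} \<le> card e"
      by (rule card_mono) (auto simp: ab)
    then show ?thesis using eps by (simp add: divide_right_mono)
  qed
  also have "\<dots> = 4 / \<epsilon>" using card_R[OF e] by simp
  also have "\<dots> \<le> 4 / \<epsilon>\<^sup>2"
    using eps power_decreasing[of 1 2 \<epsilon>] by (intro divide_left_mono) auto
  also have "\<dots> \<le> 12 / \<epsilon>\<^sup>2" using eps by (intro divide_right_mono) auto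
  finally have "\<bar>\<Sum>w\<in>nbrs R v. term_step v x w e d\<bar> / real \<Delta> \<le> 12 / \<epsilon>\<^sup>2 / real \<Delta>"
    by (rule divide_right_mono) simp
  then show ?thesis by (simp add: load_step_eq abs_divide)
qed

end

section \<open>Summed drift and variation of the overlaps\<close>

lemma mean_swap: "mean A (\<lambda>a. mean T (\<lambda>c. f c a)) = mean T (\<lambda>c. mean A (f c))"
proof -
  have "mean A (\<lambda>a. mean T (\<lambda>c. f c a)) = (\<Sum>a\<in>A. \<Sum>c\<in>T. f c a) / (real (card T) * real (card A))"
    by (simp add: mean_def sum_divide_distrib[symmetric])
  also have "\<dots> = mean T (\<lambda>c. mean A (f c))"
    by (subst sum.swap) (simp add: mean_def sum_divide_distrib[symmetric] mult.commute)
  finally show ?thesis .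
qed

lemma abs_overlap_change_le:
  assumes S: "finite S" "2 \<le> card S" and d: "d \<in> S"
  shows "\<bar>overlap g (S - {d}) T - overlap g S T\<bar> \<le> real g / ((real (card S) - 1) * real (card T))"
proof (cases "card T = 0")
  case False
  define a b x where "a = real (card S)" and "b = real (card T)" and "x = real (card (S \<inter> T))"
  define i where "i = (if d \<in> T then 1 else 0 :: real)"
  have ab: "2 \<le> a" "0 < b" using S False by (auto simp: a_def b_def)
  have x: "0 \<le> x" "x \<le> a"
    using card_mono[OF S(1), of "S \<inter> T"] by (auto simp: x_def a_def)
  have "real (card (S \<inter> T)) = real (card ((S - {d}) \<inter> T)) + i"
  proof (cases "d \<in> T")
    case True
    then have "S \<inter> T = insert d ((S - {d}) \<inter> T)" using d by auto
    then have "card (S \<inter> T) = Suc (card ((S - {d}) \<inter> T))"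
      using S(1) by (metis Diff_iff IntD1 card_insert_disjoint finite_Diff finite_Int insertI1)
    then show ?thesis using True by (simp add: i_def)
  next
    case False
    then have "(S - {d}) \<inter> T = S \<inter> T" by auto
    then show ?thesis using False by (simp add: i_def)
  qed
  then have x': "real (card ((S - {d}) \<inter> T)) = x - i" by (simp add: x_def)
  have a': "real (card (S - {d})) = a - 1"
    using d S by (simp add: a_def card_Diff_singleton of_nat_diff)
  \<comment> \<open>Both x = |S \<inter> T| and a * i lie between 0 and a, so the last factor is at
    most 1 in absolute value.\<close>
  have "overlap g (S - {d}) T - overlap g S T = real g / ((a - 1) * b) * ((x - a * i) / a)"
    unfolding overlap_def x' a' a_def[symmetric] b_def[symmetric] x_def[symmetric]
    using ab by (simp add: field_simps)
  also have "\<bar>\<dots>\<bar> = real g / ((a - 1) * b) * (\<bar>x - a * i\<bar> / a)"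
    using ab by (simp add: abs_mult abs_divide)
  also have "\<dots> \<le> real g / ((a - 1) * b) * 1"
    using ab x by (intro mult_left_mono) (auto simp: i_def)
  finally show ?thesis by (simp add: a_def b_def)
qed (simp add: overlap_def)

context tracked_state
begin

definition overlap_step :: "nat \<Rightarrow> nat \<Rightarrow> edge \<Rightarrow> color \<Rightarrow> real" where
  "overlap_step u v e d = overlap g (use_color e d F u) (use_color e d F v) - overlap g (F u) (F v)"

text \<open>The overlap is the mean of the shares of one set over the other, so while
  \<open>F v\<close> stays fixed the bounds on share drifts carry over by averaging.\<close>

lemma overlap_step_single:
  "overlap g (F u - {d}) (F v) - overlap g (F u) (F v) = mean (F v) (\<lambda>c. share_step c u d)"
  unfolding overlap_eq_mean_share[OF finite_F] share_step_def
  by (simp add: mean_def sum_subtractf diff_divide_distrib)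

lemma overlap_step_eq:
  assumes "e \<in> R" "u \<noteq> v"
  shows "overlap_step u v e d =
    (if e = {u, v} then overlap_step u v e d
     else if u \<in> e then mean (F v) (\<lambda>c. share_step c u d)
     else if v \<in> e then mean (F u) (\<lambda>c. share_step c v d) else 0)"
proof -
  have "e = {u, v}" if "u \<in> e" "v \<in> e"
    using that card_R[OF assms(1)] assms(2) by (auto simp: card_2_iff)
  then consider "e = {u, v}" | "e \<noteq> {u, v}" "u \<in> e" "v \<notin> e" | "e \<noteq> {u, v}" "u \<notin> e" "v \<in> e"
    | "e \<noteq> {u, v}" "u \<notin> e" "v \<notin> e" by blast
  then show ?thesis
  proof cases
    case 3
    then have "overlap_step u v e d = overlap g (F u) (F v - {d}) - overlap g (F u) (F v)"
      by (simp add: overlap_step_def use_color_def)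
    also have "\<dots> = mean (F u) (\<lambda>c. share_step c v d)"
      using overlap_step_single[of v d u] by (simp add: overlap_commute)
    finally show ?thesis using 3 by simp
  qed (auto simp: overlap_step_def use_color_def overlap_step_single)
qed

text \<open>The edge may meet both vertices, so the sets are changed one after the other, first that
  of v and then that of u. The factors 2 and 4 come from replacing sizes diminished by 1 by half the
  sizes; 2 + 4 = 6 is then doubled by g \<le> 2\<Delta>.\<close>

lemma abs_overlap_step_le:
  assumes d: "d \<in> admissible g F e"
  shows "\<bar>overlap_step u v e d\<bar> \<le> 12 / (\<epsilon>\<^sup>2 * real \<Delta>)"
proof -
  define a b where "a = real (card (F u))" and "b = real (card (F v))"
  have ab: "2 \<le> a" "2 \<le> b" "\<epsilon>\<^sup>2 * (real \<Delta>)\<^sup>2 \<le> a * b"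
    using card_F_ge2 card_sq_ge by (auto simp: a_def b_def)
  have fin: "finite (use_color e d F u)" for u using finite_F by (simp add: use_color_def)
  have u: "\<bar>overlap g (use_color e d F u) T - overlap g (F u) T\<bar> \<le> real g / ((real (card (F u)) - 1) * real (card T))"
    for u T
  proof (cases "u \<in> e")
    case True
    then have "d \<in> F u" using d by (auto simp: admissible_def)
    then show ?thesis
      using abs_overlap_change_le[OF finite_F, of u d g T] card_F_ge2[of u] True
      by (simp add: use_color_def)
  next
    case False
    then show ?thesis using card_F_ge2[of u] by (simp add: use_color_def)
  qed
  have card_use: "b - 1 \<le> real (card (use_color e d F v))"
    using card_F_ge2[of v] finite_F[of v] by (auto simp: use_color_def b_def card_Diff_singleton_if of_nat_diff)
  have "\<bar>overlap g (F u) (use_color e d F v) - overlap g (F u) (F v)\<bar> \<le> real g / ((b - 1) * a)"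
    using u[of v "F u"] by (simp add: overlap_commute a_def b_def)
  also have "\<dots> \<le> real g / ((b / 2) * a)"
    using ab by (intro divide_left_mono mult_right_mono) auto
  finally have 1: "\<bar>overlap g (F u) (use_color e d F v) - overlap g (F u) (F v)\<bar> \<le> 2 * (real g / (a * b))"
    by (simp add: mult.commute)
  have "\<bar>overlap g (use_color e d F u) (use_color e d F v) - overlap g (F u) (use_color e d F v)\<bar>
      \<le> real g / ((a - 1) * real (card (use_color e d F v)))"
    using u[of u] by (simp add: a_def)
  also have "\<dots> \<le> real g / ((a / 2) * (b / 2))"
    using ab card_use by (intro divide_left_mono mult_mono) auto
  finally have 2: "\<bar>overlap g (use_color e d F u) (use_color e d F v) - overlap g (F u) (use_color e d F v)\<bar>
      \<le> 4 * (real g / (a * b))" by (simp add: mult.commute)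
  have "\<bar>overlap_step u v e d\<bar> \<le> 6 * (real g / (a * b))"
    unfolding overlap_step_def using 1 2 by linarith
  also have "real g / (a * b) \<le> 2 * real \<Delta> / (\<epsilon>\<^sup>2 * (real \<Delta>)\<^sup>2)"
    using ab g_le eps Delta_pos by (intro frac_le) auto
  also have "6 * (2 * real \<Delta> / (\<epsilon>\<^sup>2 * (real \<Delta>)\<^sup>2)) = 12 / (\<epsilon>\<^sup>2 * real \<Delta>)"
    using Delta_pos eps by (simp add: field_simps power2_eq_square)
  finally show ?thesis by simp
qed

lemma abs_mean_share_step_le:
  assumes "{u, v} \<in> R"
  shows "\<bar>mean (admissible g F {u, v}) (\<lambda>d. mean T (\<lambda>c. share_step c u d))\<bar> \<le> 20 * B / \<epsilon> ^ 3"
proof -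
  have "20 / (\<epsilon> ^ 3 * real \<Delta>) = 20 / \<epsilon> ^ 3 * (1 / real \<Delta>)" by simp
  also have "\<dots> \<le> 20 / \<epsilon> ^ 3 * B" using inverse_Delta_le eps by (intro mult_left_mono) auto
  finally have "\<bar>mean (admissible g F {u, v}) (share_step c u)\<bar> \<le> 20 * B / \<epsilon> ^ 3" for c
    using abs_mean_share_change_le[OF assms, of c] by (simp add: share_step_def[abs_def])
  then show ?thesis
    using eps B_nonneg by (subst mean_swap) (rule order_trans[OF abs_mean_le mean_le_const], auto)
qed

lemma single_drift:
  assumes "u \<in> V"
  shows "\<bar>\<Sum>e\<in>{e \<in> R. u \<in> e}. mean (admissible g F e) (\<lambda>d. mean T (\<lambda>c. share_step c u d))\<bar>
    \<le> 24 * B / \<epsilon> ^ 3"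
proof -
  have "(\<Sum>e\<in>{e \<in> R. u \<in> e}. mean (admissible g F e) (\<lambda>d. mean T (\<lambda>c. share_step c u d))) =
      mean T (\<lambda>c. \<Sum>e\<in>{e \<in> R. u \<in> e}. mean (admissible g F e) (share_step c u))"
    unfolding mean_sum by (intro sum.cong refl mean_swap)
  then show ?thesis
    using share_drift[OF assms] eps B_nonneg
    by (auto intro!: order_trans[OF abs_mean_le mean_le_const])
qed

text \<open>Edges at u contribute share drifts at u averaged over \<open>F v\<close>, edges at v
  symmetrically; only \<open>{u, v}\<close> acts on both sets at once and enters through a
  correction of order 1/\<Delta>. The bounds add up to 24 + 24 + 12 + 20 + 20 = 100, the constant
  behind \<open>growth\<close>.\<close>

lemma overlap_drift:
  assumes uv: "u \<in> V" "v \<in> V" "u \<noteq> v"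
  shows "\<bar>\<Sum>e\<in>R. mean (admissible g F e) (overlap_step u v e)\<bar> \<le> 100 * B / \<epsilon> ^ 3"
proof -
  define p where "p = (\<lambda>e. mean (admissible g F e) (\<lambda>d. mean (F v) (\<lambda>c. share_step c u d)))"
  define q where "q = (\<lambda>e. mean (admissible g F e) (\<lambda>d. mean (F u) (\<lambda>c. share_step c v d)))"
  define j where "j = (\<lambda>e. mean (admissible g F e) (overlap_step u v e))"
  have e3: "\<epsilon> ^ 3 \<le> 1" "0 < \<epsilon> ^ 3" using eps by (auto intro: power_le_one)
  have "(\<Sum>e\<in>R. j e) =
      (\<Sum>e\<in>R. if e = {u, v} then j e else if u \<in> e then p e else if v \<in> e then q e else 0)"
  proof (rule sum.cong[OF refl])
    fix e assume "e \<in> R"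
    note step = overlap_step_eq[OF this uv(3)]
    have "e \<noteq> {u, v} \<Longrightarrow> u \<in> e \<Longrightarrow> j e = p e"
      unfolding j_def p_def by (intro mean_cong) (subst step, simp)
    moreover have "e \<noteq> {u, v} \<Longrightarrow> u \<notin> e \<Longrightarrow> v \<in> e \<Longrightarrow> j e = q e"
      unfolding j_def q_def by (intro mean_cong) (subst step, simp)
    moreover have "j e = 0" if "e \<noteq> {u, v}" "u \<notin> e" "v \<notin> e"
    proof -
      have "j e = mean (admissible g F e) (\<lambda>_. 0)"
        unfolding j_def using that by (intro mean_cong) (subst step, simp)
      then show ?thesis by (simp add: mean_def)
    qed
    ultimately show "j e = (if e = {u, v} then j e else if u \<in> e then p e else if v \<in> e then q e else 0)"
      by (metis (full_types))
  qed
  also have "\<dots> = (\<Sum>e\<in>{e \<in> R. u \<in> e}. p e) + (\<Sum>e\<in>{e \<in> R. v \<in> e}. q e)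
    + (if {u, v} \<in> R then j {u, v} - p {u, v} - q {u, v} else 0)"
    by (rule sum_two_vertices_R[OF uv(3)])
  finally have eq: "(\<Sum>e\<in>R. j e) = (\<Sum>e\<in>{e \<in> R. u \<in> e}. p e) + (\<Sum>e\<in>{e \<in> R. v \<in> e}. q e)
    + (if {u, v} \<in> R then j {u, v} - p {u, v} - q {u, v} else 0)" .
  have "\<bar>j e\<bar> \<le> 12 / (\<epsilon>\<^sup>2 * real \<Delta>)" for e
    unfolding j_def using abs_overlap_step_le eps by (intro order_trans[OF abs_mean_le mean_le_const]) auto
  also have "12 / (\<epsilon>\<^sup>2 * real \<Delta>) = 12 / \<epsilon>\<^sup>2 * (1 / real \<Delta>)" by simp
  also have "\<dots> \<le> 12 / \<epsilon> ^ 3 * B"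
    using inverse_Delta_le eps power_decreasing[of 2 3 \<epsilon>]
    by (intro mult_mono divide_left_mono) auto
  finally have j: "\<bar>j e\<bar> \<le> 12 * B / \<epsilon> ^ 3" for e by simp
  have pq: "\<bar>p {u, v}\<bar> \<le> 20 * B / \<epsilon> ^ 3" "\<bar>q {u, v}\<bar> \<le> 20 * B / \<epsilon> ^ 3" if "{u, v} \<in> R"
    using that abs_mean_share_step_le[of u v "F v"] abs_mean_share_step_le[of v u "F u"]
    by (auto simp: p_def q_def insert_commute)
  have "\<bar>if {u, v} \<in> R then j {u, v} - p {u, v} - q {u, v} else 0\<bar> \<le>
      12 * B / \<epsilon> ^ 3 + 20 * B / \<epsilon> ^ 3 + 20 * B / \<epsilon> ^ 3"
  proof (cases "{u, v} \<in> R")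
    case True
    then show ?thesis using j[of "{u, v}"] pq by simp
  next
    case False
    then show ?thesis using e3 B_nonneg by simp
  qed
  moreover have "\<bar>\<Sum>e\<in>{e \<in> R. u \<in> e}. p e\<bar> \<le> 24 * B / \<epsilon> ^ 3" "\<bar>\<Sum>e\<in>{e \<in> R. v \<in> e}. q e\<bar> \<le> 24 * B / \<epsilon> ^ 3"
    using single_drift uv by (auto simp: p_def q_def)
  ultimately have "\<bar>\<Sum>e\<in>R. j e\<bar> \<le>
      24 * B / \<epsilon> ^ 3 + 24 * B / \<epsilon> ^ 3 + (12 * B / \<epsilon> ^ 3 + 20 * B / \<epsilon> ^ 3 + 20 * B / \<epsilon> ^ 3)"
    unfolding eq by linarith
  also have "\<dots> = 100 * B / \<epsilon> ^ 3" by (simp add: add_divide_distrib[symmetric])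
  finally show ?thesis by (simp add: j_def)
qed

lemma overlap_variation:
  assumes uv: "u \<noteq> v"
  shows "(\<Sum>e\<in>R. mean (admissible g F e) (\<lambda>d. \<bar>overlap_step u v e d\<bar>)) \<le> 24 / \<epsilon> ^ 3"
proof -
  define K where "K = 12 / (\<epsilon>\<^sup>2 * real \<Delta>)"
  have K: "0 \<le> K" by (simp add: K_def)
  have "(\<Sum>e\<in>R. mean (admissible g F e) (\<lambda>d. \<bar>overlap_step u v e d\<bar>)) \<le>
      (\<Sum>e\<in>R. if e = {u, v} then K else if u \<in> e then K else if v \<in> e then K else 0)"
  proof (rule sum_mono)
    fix e assume e: "e \<in> R"
    have le: "mean (admissible g F e) (\<lambda>d. \<bar>overlap_step u v e d\<bar>) \<le> K"
      using abs_overlap_step_le K by (intro mean_le_const) (auto simp: K_def)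
    have zero: "mean (admissible g F e) (\<lambda>d. \<bar>overlap_step u v e d\<bar>) = 0" if "u \<notin> e" "v \<notin> e"
      using that by (simp add: overlap_step_def use_color_def mean_def)
    show "mean (admissible g F e) (\<lambda>d. \<bar>overlap_step u v e d\<bar>) \<le>
        (if e = {u, v} then K else if u \<in> e then K else if v \<in> e then K else 0)"
    proof (cases "u \<in> e \<or> v \<in> e")
      case True
      then show ?thesis using le by (simp only: if_cancel split: if_split) blast
    next
      case False
      then show ?thesis using zero K by simp
    qed
  qed
  also have "\<dots> \<le> (\<Sum>e\<in>{e \<in> R. u \<in> e}. K) + (\<Sum>e\<in>{e \<in> R. v \<in> e}. K)"
    using sum_two_vertices_R[OF uv, of "\<lambda>_. K" "\<lambda>_. K" "\<lambda>_. K"] K by (simp split: if_splits)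
  also have "\<dots> \<le> real \<Delta> * K + real \<Delta> * K"
    using K by (intro add_mono sum_incident_le) auto
  also have "\<dots> = 24 / \<epsilon>\<^sup>2" using Delta_pos by (simp add: K_def field_simps)
  also have "\<dots> \<le> 24 / \<epsilon> ^ 3"
    using eps power_decreasing[of 2 3 \<epsilon>] by (intro divide_left_mono) auto
  finally show ?thesis .
qed

end

section \<open>Random orders\<close>

lemma length_play: "h \<in> set_pmf (play B C k) \<Longrightarrow> length h = k"
  by (induction k arbitrary: h) auto

lemma play_cong:
  "(\<And>h. length h < k \<Longrightarrow> B h = B' h) \<Longrightarrow> play B C k = play B' C k"
proof (induction k)
  case (Suc k)
  then have eq: "play B C k = play B' C k" by simp
  have "B h = B' h" if "h \<in> set_pmf (play B' C k)" for h
    using Suc.prems[of h] length_play[OF that] by simp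
  then show ?case
    unfolding play.simps eq by (intro bind_pmf_cong refl) simp
qed simp

definition slot :: "edge set \<Rightarrow> (edge \<Rightarrow> nat) \<Rightarrow> nat \<Rightarrow> edge" where
  "slot E \<sigma> i = (if i \<in> \<sigma> ` E then inv_into E \<sigma> i else {})"

lemma obl_eq_slot: "obl E \<sigma> h = slot E \<sigma> (Suc (length h))"
  by (simp add: obl_def slot_def Let_def)

lemma slot_at: "inj_on \<sigma> E \<Longrightarrow> e \<in> E \<Longrightarrow> slot E \<sigma> (\<sigma> e) = e"
  by (simp add: slot_def inv_into_f_f)

lemma slot_empty: "i \<notin> \<sigma> ` E \<Longrightarrow> slot E \<sigma> i = {}"
  by (simp add: slot_def)

lemma finite_edge_orders: "finite E \<Longrightarrow> finite (edge_orders E m)"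
  unfolding edge_orders_def by (rule finite_subset[of _ "E \<rightarrow>\<^sub>E {1..m}"]) (auto intro: finite_PiE)

lemma edge_ordersD:
  assumes "\<sigma> \<in> edge_orders E m"
  shows "inj_on \<sigma> E" "\<And>e. e \<in> E \<Longrightarrow> 1 \<le> \<sigma> e" "\<And>e. e \<in> E \<Longrightarrow> \<sigma> e \<le> m"
  using assms by (auto simp: edge_orders_def)

definition swap_slots :: "edge set \<Rightarrow> nat \<Rightarrow> nat \<Rightarrow> (edge \<Rightarrow> nat) \<Rightarrow> edge \<Rightarrow> nat" where
  "swap_slots E i j \<sigma> = restrict (\<lambda>e. Transposition.transpose i j (\<sigma> e)) E"

lemma swap_slots_in:
  assumes "\<sigma> \<in> edge_orders E m" "i \<in> {1..m}" "j \<in> {1..m}"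
  shows "swap_slots E i j \<sigma> \<in> edge_orders E m"
proof -
  have "inj_on (\<lambda>e. Transposition.transpose i j (\<sigma> e)) E"
    using edge_ordersD(1)[OF assms(1)] unfolding inj_on_def by (metis transpose_eq_imp_eq)
  moreover have "Transposition.transpose i j (\<sigma> e) \<in> {1..m}" if "e \<in> E" for e
    using edge_ordersD(2,3)[OF assms(1) that] assms(2,3) by (auto simp: Transposition.transpose_def)
  ultimately show ?thesis
    by (auto simp: edge_orders_def swap_slots_def inj_on_def)
qed

lemma swap_slots_swap: "\<sigma> \<in> edge_orders E m \<Longrightarrow> swap_slots E i j (swap_slots E i j \<sigma>) = \<sigma>"
  by (auto simp: swap_slots_def edge_orders_def PiE_def extensional_def restrict_def)

lemma slot_swap_slots:
  assumes "\<sigma> \<in> edge_orders E m"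
  shows "slot E (swap_slots E i j \<sigma>) l = slot E \<sigma> (Transposition.transpose i j l)"
proof (cases "Transposition.transpose i j l \<in> \<sigma> ` E")
  case True
  then obtain e where e: "e \<in> E" "\<sigma> e = Transposition.transpose i j l" by auto
  then have l: "swap_slots E i j \<sigma> e = l" by (simp add: swap_slots_def)
  have "inj_on (swap_slots E i j \<sigma>) E"
    using edge_ordersD(1)[OF assms] by (simp add: inj_on_def swap_slots_def) (metis transpose_eq_imp_eq)
  then have "slot E (swap_slots E i j \<sigma>) l = e" using slot_at e(1) l by metis
  moreover have "slot E \<sigma> (Transposition.transpose i j l) = e"
    using slot_at[OF edge_ordersD(1)[OF assms] e(1)] e(2) by simp
  ultimately show ?thesis by simp
next
  case False
  have "l \<notin> swap_slots E i j \<sigma> ` E"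
  proof
    assume "l \<in> swap_slots E i j \<sigma> ` E"
    then obtain e where "e \<in> E" "l = Transposition.transpose i j (\<sigma> e)" by (auto simp: swap_slots_def)
    then have "Transposition.transpose i j l = \<sigma> e" by simp
    then show False using False \<open>e \<in> E\<close> by auto
  qed
  then show ?thesis using False by (simp add: slot_empty)
qed

definition random_play :: "edge set \<Rightarrow> nat \<Rightarrow> colorer \<Rightarrow> nat \<Rightarrow> history pmf" where
  "random_play E m C k = bind_pmf (pmf_of_set (edge_orders E m)) (\<lambda>\<sigma>. play (obl E \<sigma>) C k)"

text \<open>Resampling the slot of the next move among the slots still to come does not change the
  distribution of the history when the order of the edges is itself uniformly random.\<close>

definition next_move ::
    "edge set \<Rightarrow> nat \<Rightarrow> colorer \<Rightarrow> (edge \<Rightarrow> nat) \<Rightarrow> history \<Rightarrow> (edge \<times> color option) pmf" where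
  "next_move E m C \<sigma> h = bind_pmf (pmf_of_set {Suc (length h)..m})
     (\<lambda>j. map_pmf (Pair (slot E \<sigma> j)) (C h (slot E \<sigma> j)))"

lemma random_play_Suc:
  assumes E: "finite E" "edge_orders E m \<noteq> {}" and k: "k < m"
  shows "random_play E m C (Suc k) = bind_pmf (pmf_of_set (edge_orders E m))
    (\<lambda>\<sigma>. bind_pmf (play (obl E \<sigma>) C k) (\<lambda>h. map_pmf (\<lambda>x. h @ [x]) (next_move E m C \<sigma> h)))"
proof -
  define Os where "Os = edge_orders E m"
  have Os: "finite Os" "Os \<noteq> {}" using E finite_edge_orders by (auto simp: Os_def)
  define D where "D = (\<lambda>j. bind_pmf (pmf_of_set Os) (\<lambda>\<sigma>. bind_pmf (play (obl E \<sigma>) C k)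
    (\<lambda>h. map_pmf (\<lambda>c. h @ [(slot E \<sigma> j, c)]) (C h (slot E \<sigma> j)))))"
  \<comment> \<open>Exchanging the slots k + 1 and j permutes the orders. As j > k, it does not
    affect the first k moves, while the edge in slot j becomes the one in slot k + 1. So
    \<open>D j\<close> is the true law of the next history for each such j, and averaging over j
    changes nothing.\<close>
  have "D j = random_play E m C (Suc k)" if j: "j \<in> {Suc k..m}" for j
  proof -
    define \<tau> where "\<tau> = swap_slots E (Suc k) j"
    have \<tau>Os: "\<tau> \<sigma> \<in> Os" if "\<sigma> \<in> Os" for \<sigma>
      using that j k swap_slots_in[of \<sigma> E m "Suc k" j] by (auto simp: Os_def \<tau>_def)
    have "bij_betw \<tau> Os Os"
      by (rule bij_betw_byWitness[of _ \<tau>]) (use \<tau>Os in \<open>auto simp: Os_def \<tau>_def swap_slots_swap\<close>)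
    then have "map_pmf \<tau> (pmf_of_set Os) = pmf_of_set Os"
      using Os by (intro map_pmf_of_set_bij_betw)
    then have "D j = bind_pmf (map_pmf \<tau> (pmf_of_set Os)) (\<lambda>\<sigma>. bind_pmf (play (obl E \<sigma>) C k)
        (\<lambda>h. map_pmf (\<lambda>c. h @ [(slot E \<sigma> j, c)]) (C h (slot E \<sigma> j))))"
      by (simp add: D_def)
    also have "\<dots> = bind_pmf (pmf_of_set Os) (\<lambda>\<sigma>. bind_pmf (play (obl E (\<tau> \<sigma>)) C k)
        (\<lambda>h. map_pmf (\<lambda>c. h @ [(slot E (\<tau> \<sigma>) j, c)]) (C h (slot E (\<tau> \<sigma>) j))))"
      by (rule bind_map_pmf)
    also have "\<dots> = bind_pmf (pmf_of_set Os) (\<lambda>\<sigma>. play (obl E \<sigma>) C (Suc k))"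
    proof (intro bind_pmf_cong refl)
      fix \<sigma> assume "\<sigma> \<in> set_pmf (pmf_of_set Os)"
      then have \<sigma>: "\<sigma> \<in> edge_orders E m" using Os by (simp add: Os_def)
      have j': "slot E (\<tau> \<sigma>) j = slot E \<sigma> (Suc k)"
        by (simp add: \<tau>_def slot_swap_slots[OF \<sigma>])
      have "play (obl E (\<tau> \<sigma>)) C k = play (obl E \<sigma>) C k"
      proof (rule play_cong)
        fix h :: history assume "length h < k"
        then have "Transposition.transpose (Suc k) j (Suc (length h)) = Suc (length h)"
          using j by (auto simp: Transposition.transpose_def)
        then show "obl E (\<tau> \<sigma>) h = obl E \<sigma> h"
          by (simp add: obl_eq_slot \<tau>_def slot_swap_slots[OF \<sigma>])
      qed
      then show "bind_pmf (play (obl E (\<tau> \<sigma>)) C k)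
          (\<lambda>h. map_pmf (\<lambda>c. h @ [(slot E (\<tau> \<sigma>) j, c)]) (C h (slot E (\<tau> \<sigma>) j))) =
        play (obl E \<sigma>) C (Suc k)"
        unfolding j' by (auto intro!: bind_pmf_cong simp: obl_eq_slot dest: length_play)
    qed
    finally show ?thesis by (simp add: random_play_def Os_def)
  qed
  then have "random_play E m C (Suc k) = bind_pmf (pmf_of_set {Suc k..m}) D"
    using k by (subst bind_pmf_cong[of _ _ D "\<lambda>_. random_play E m C (Suc k)"]) auto
  also have "\<dots> = bind_pmf (pmf_of_set Os) (\<lambda>\<sigma>. bind_pmf (play (obl E \<sigma>) C k) (\<lambda>h.
      bind_pmf (pmf_of_set {Suc k..m}) (\<lambda>j. map_pmf (\<lambda>c. h @ [(slot E \<sigma> j, c)]) (C h (slot E \<sigma> j)))))"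
    unfolding D_def by (subst bind_commute_pmf, intro bind_pmf_cong refl, rule bind_commute_pmf)
  also have "\<dots> = bind_pmf (pmf_of_set Os) (\<lambda>\<sigma>. bind_pmf (play (obl E \<sigma>) C k)
      (\<lambda>h. map_pmf (\<lambda>x. h @ [x]) (next_move E m C \<sigma> h)))"
    by (intro bind_pmf_cong refl)
      (auto dest!: length_play simp: next_move_def map_bind_pmf map_pmf_comp)
  finally show ?thesis by (simp add: Os_def)
qed

section \<open>Exponential supermartingales\<close>

text \<open>For negative x, with y = -x, the product (1 - y + y^2) (1 + y + y^2/2) is at least 1,
  and its second factor is at most exp y.\<close>

lemma exp_le_quadratic:
  fixes x :: real
  assumes "\<bar>x\<bar> \<le> 1"
  shows "exp x \<le> 1 + x + x\<^sup>2"
proof (cases "0 \<le> x")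
  case True
  then show ?thesis using exp_bound[of x] assms by simp
next
  case False
  define y where "y = - x"
  have y: "0 < y" "y \<le> 1" using False assms by (auto simp: y_def)
  have "1 \<le> 1 + y\<^sup>2 / 2 + y ^ 3 / 2 + y ^ 4 / 2" using y by simp
  also have "\<dots> = (1 - y + y\<^sup>2) * (1 + y + y\<^sup>2 / 2)"
    by (simp add: field_simps power2_eq_square power3_eq_cube power4_eq_xxxx)
  also have "\<dots> \<le> (1 - y + y\<^sup>2) * exp y"
    using y exp_lower_Taylor_quadratic[of y] by (intro mult_left_mono) auto
  finally have "exp (- y) \<le> 1 - y + y\<^sup>2"
    by (simp add: exp_minus field_simps)
  then show ?thesis by (simp add: y_def)
qed

text \<open>The second moment is bounded by the largest jump times the mean absolute change, E Y^2
  \<le> L E|Y|. This is far below L^2 when most moves hardly affect the tracked quantity. The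
  negative drift \<eta> then compensates the quadratic term of the exponential for t up to \<eta> /
  (L \<rho>).\<close>

lemma exp_moment_le_1:
  fixes Y :: "'a \<Rightarrow> real"
  assumes fin: "finite (set_pmf p)"
    and jump: "\<And>x. x \<in> set_pmf p \<Longrightarrow> \<bar>Y x\<bar> \<le> L"
    and drift: "measure_pmf.expectation p Y \<le> - \<eta>"
    and var: "measure_pmf.expectation p (\<lambda>x. \<bar>Y x\<bar>) \<le> \<rho>"
    and lam: "0 \<le> t" "t * L \<le> 1" "t * L * \<rho> \<le> \<eta>" and L: "0 \<le> L"
  shows "measure_pmf.expectation p (\<lambda>x. exp (t * Y x)) \<le> 1"
proof -
  note int = integrable_measure_pmf_finite[OF fin]
  have "measure_pmf.expectation p (\<lambda>x. exp (t * Y x)) \<le>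
      measure_pmf.expectation p (\<lambda>x. 1 + t * Y x + t\<^sup>2 * L * \<bar>Y x\<bar>)"
  proof (intro integral_mono_AE int AE_pmfI)
    fix x assume "x \<in> set_pmf p"
    then have Y: "\<bar>Y x\<bar> \<le> L" by (rule jump)
    have "\<bar>t * Y x\<bar> \<le> t * L" using Y lam(1) by (simp add: abs_mult mult_left_mono)
    then have "exp (t * Y x) \<le> 1 + t * Y x + (t * Y x)\<^sup>2"
      using lam(2) by (intro exp_le_quadratic) simp
    also have "(t * Y x)\<^sup>2 = t\<^sup>2 * (\<bar>Y x\<bar> * \<bar>Y x\<bar>)"
      by (simp add: power2_eq_square abs_mult[symmetric])
    also have "\<dots> \<le> t\<^sup>2 * (L * \<bar>Y x\<bar>)"
      using Y by (intro mult_left_mono mult_right_mono) auto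
    finally show "exp (t * Y x) \<le> 1 + t * Y x + t\<^sup>2 * L * \<bar>Y x\<bar>" by simp
  qed
  also have "\<dots> = 1 + t * measure_pmf.expectation p Y
      + t\<^sup>2 * L * measure_pmf.expectation p (\<lambda>x. \<bar>Y x\<bar>)"
    by (simp add: int)
  also have "\<dots> \<le> 1 + t * (- \<eta>) + t\<^sup>2 * L * \<rho>"
    using drift var lam L by (intro add_mono mult_left_mono) auto
  also have "\<dots> = 1 + t * (t * L * \<rho> - \<eta>)" by (simp add: algebra_simps power2_eq_square)
  also have "\<dots> \<le> 1"
    using lam by (simp add: mult_nonneg_nonpos)
  finally show ?thesis .
qed

text \<open>Every prefix is tested, so tameness once lost is never regained; the first violation
  acts as a stopping time.\<close>

definition tame :: "('i \<Rightarrow> history \<Rightarrow> real) \<Rightarrow> (nat \<Rightarrow> real) \<Rightarrow> 'i set \<Rightarrow> history \<Rightarrow> bool" where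
  "tame q b I h \<longleftrightarrow> (\<forall>k\<le>length h. \<forall>i\<in>I. \<bar>q i (take k h)\<bar> \<le> b k)"

lemma tame_snoc:
  "tame q b I (h @ [x]) \<longleftrightarrow> tame q b I h \<and> (\<forall>i\<in>I. \<bar>q i (h @ [x])\<bar> \<le> b (Suc (length h)))"
  unfolding tame_def by (auto simp: le_Suc_eq)

lemma tame_take: "tame q b I h \<Longrightarrow> tame q b I (take k h)"
  by (auto simp: tame_def min_def)

text \<open>The sum of the exponentials \<open>exp (t (\<plusminus> q i h - b k))\<close> is a supermartingale as long as
  the history is tame, and it is at least \<open>1\<close> at the moment when tameness is lost.\<close>

lemma prob_not_tame_le:
  fixes q :: "'i \<Rightarrow> history \<Rightarrow> real"
  assumes E: "finite E" "edge_orders E m \<noteq> {}" and T: "T \<le> m" and I: "finite I"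
    and fin: "\<And>h e. finite (set_pmf (C h e))"
    and lam: "0 \<le> t"
    and start: "\<And>i. i \<in> I \<Longrightarrow> q i [] = 0" "0 \<le> b 0"
    and step: "\<And>k \<sigma> h i s. k < T \<Longrightarrow> \<sigma> \<in> edge_orders E m \<Longrightarrow> h \<in> set_pmf (play (obl E \<sigma>) C k) \<Longrightarrow>
       tame q b I h \<Longrightarrow> i \<in> I \<Longrightarrow> s \<in> {1, -1} \<Longrightarrow>
       measure_pmf.expectation (next_move E m C \<sigma> h)
         (\<lambda>x. exp (t * (s * (q i (h @ [x]) - q i h) - (b (Suc k) - b k)))) \<le> 1"
  shows "measure_pmf.prob (random_play E m C T) {h. \<not> tame q b I h} \<le>
    2 * real (card I) * exp (- t * b 0)"
proof -
  define \<Psi> where "\<Psi> = (\<lambda>h. \<Sum>i\<in>I. \<Sum>s\<in>{1, -1}. exp (t * (s * q i h - b (length h))))"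
  \<comment> \<open>The process is stopped at the first violation and frozen at 1, a value that
    \<open>\<Psi>\<close> has at least reached by then; afterwards no drift estimate is
    available.\<close>
  define W where "W = (\<lambda>h. if tame q b I h then \<Psi> h else 1)"
  have \<Psi>_nonneg: "0 \<le> \<Psi> h" for h by (auto simp: \<Psi>_def intro!: sum_nonneg)
  have W_nonneg: "0 \<le> W h" for h using \<Psi>_nonneg by (simp add: W_def)
  have W_le: "W (h @ [x]) \<le> \<Psi> (h @ [x])" if h: "tame q b I h" for h x
  proof (cases "tame q b I (h @ [x])")
    case False
    then obtain i where i: "i \<in> I" "b (Suc (length h)) < \<bar>q i (h @ [x])\<bar>"
      using h by (auto simp: tame_snoc)
    define s :: real where "s = (if 0 \<le> q i (h @ [x]) then 1 else -1)"
    have s: "s \<in> {1, -1}" "s * q i (h @ [x]) = \<bar>q i (h @ [x])\<bar>" by (auto simp: s_def)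
    have "1 \<le> exp (t * (s * q i (h @ [x]) - b (length (h @ [x]))))"
      using i(2) s(2) lam by simp
    also have "\<dots> \<le> (\<Sum>s\<in>{1, -1}. exp (t * (s * q i (h @ [x]) - b (length (h @ [x])))))"
      using s(1) by (intro member_le_sum) auto
    also have "\<dots> \<le> \<Psi> (h @ [x])"
      unfolding \<Psi>_def using i(1) I by (intro member_le_sum[of i]) (auto intro!: sum_nonneg)
    finally show ?thesis using False by (simp add: W_def)
  qed (simp add: W_def)
  have fin_next: "finite (set_pmf (next_move E m C \<sigma> h))" if "length h < m" for \<sigma> h
    using that fin by (simp add: next_move_def)
  have next_le: "(\<integral>\<^sup>+x. ennreal (W (h @ [x])) \<partial>next_move E m C \<sigma> h) \<le> ennreal (W h)"
    if k: "k < T" and \<sigma>: "\<sigma> \<in> edge_orders E m" and h: "h \<in> set_pmf (play (obl E \<sigma>) C k)" for k \<sigma> h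
  proof (cases "tame q b I h")
    case True
    note len = length_play[OF h]
    note int = integrable_measure_pmf_finite[OF fin_next]
    have lm: "length h < m" using len k T by simp
    have "(\<integral>\<^sup>+x. ennreal (W (h @ [x])) \<partial>next_move E m C \<sigma> h) \<le>
        (\<integral>\<^sup>+x. ennreal (\<Psi> (h @ [x])) \<partial>next_move E m C \<sigma> h)"
      using W_le[OF True] by (intro nn_integral_mono ennreal_leI) auto
    also have "\<dots> = ennreal (measure_pmf.expectation (next_move E m C \<sigma> h) (\<lambda>x. \<Psi> (h @ [x])))"
      using \<Psi>_nonneg int[OF lm] by (intro nn_integral_eq_integral) auto
    also have "measure_pmf.expectation (next_move E m C \<sigma> h) (\<lambda>x. \<Psi> (h @ [x])) =
        (\<Sum>i\<in>I. \<Sum>s\<in>{1, -1}. measure_pmf.expectation (next_move E m C \<sigma> h)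
          (\<lambda>x. exp (t * (s * q i (h @ [x]) - b (Suc (length h))))))"
      unfolding \<Psi>_def by (simp add: Bochner_Integration.integral_sum int[OF lm])
    also have "\<dots> \<le> (\<Sum>i\<in>I. \<Sum>s\<in>{1, -1}. exp (t * (s * q i h - b (length h))))"
    proof (intro sum_mono)
      fix i and s :: real assume i: "i \<in> I" and s: "s \<in> {1, -1}"
      have "exp (t * (s * q i (h @ [x]) - b (Suc k))) =
          exp (t * (s * q i h - b k)) * exp (t * (s * (q i (h @ [x]) - q i h) - (b (Suc k) - b k)))" for x
        by (simp add: exp_add[symmetric] algebra_simps)
      then show "measure_pmf.expectation (next_move E m C \<sigma> h)
          (\<lambda>x. exp (t * (s * q i (h @ [x]) - b (Suc (length h))))) \<le> exp (t * (s * q i h - b (length h)))"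
        using step[OF k \<sigma> h True i s] by (simp add: len mult_left_le)
    qed
    finally show ?thesis using True by (simp add: W_def \<Psi>_def ennreal_leI)
  next
    case False
    then have "W (h @ [x]) = 1" for x by (simp add: W_def tame_snoc)
    then show ?thesis using False by (simp add: W_def)
  qed
  have main: "(\<integral>\<^sup>+h. ennreal (W h) \<partial>random_play E m C k) \<le> ennreal (W [])" if "k \<le> T" for k
    using that
  proof (induction k)
    case 0
    then show ?case by (simp add: random_play_def)
  next
    case (Suc k)
    then have k: "k < T" "k < m" using T by auto
    have "(\<integral>\<^sup>+h. ennreal (W h) \<partial>random_play E m C (Suc k)) =
        (\<integral>\<^sup>+\<sigma>. \<integral>\<^sup>+h. \<integral>\<^sup>+x. ennreal (W (h @ [x])) \<partial>next_move E m C \<sigma> h \<partial>play (obl E \<sigma>) C k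
          \<partial>pmf_of_set (edge_orders E m))"
      by (simp add: random_play_Suc[OF E k(2)])
    also have "\<dots> \<le> (\<integral>\<^sup>+\<sigma>. \<integral>\<^sup>+h. ennreal (W h) \<partial>play (obl E \<sigma>) C k \<partial>pmf_of_set (edge_orders E m))"
      using next_le[OF k(1)] E finite_edge_orders[OF E(1)]
      by (intro nn_integral_mono_AE AE_pmfI) auto
    also have "\<dots> = (\<integral>\<^sup>+h. ennreal (W h) \<partial>random_play E m C k)"
      by (simp add: random_play_def)
    also have "\<dots> \<le> ennreal (W [])" using Suc by simp
    finally show ?case .
  qed
  \<comment> \<open>Each index contributes two signs, each with exp (- t * b 0) because the
    deviations start at 0.\<close>
  have W0: "W [] \<le> 2 * real (card I) * exp (- t * b 0)"
    using start by (auto simp: W_def \<Psi>_def tame_def)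
  have "ennreal (measure_pmf.prob (random_play E m C T) {h. \<not> tame q b I h}) =
      emeasure (random_play E m C T) {h. \<not> tame q b I h}"
    by (simp add: measure_pmf.emeasure_eq_measure)
  also have "\<dots> = (\<integral>\<^sup>+h. indicator {h. \<not> tame q b I h} h \<partial>random_play E m C T)"
    by simp
  also have "\<dots> \<le> (\<integral>\<^sup>+h. ennreal (W h) \<partial>random_play E m C T)"
    by (intro nn_integral_mono) (auto simp: W_def indicator_def)
  also have "\<dots> \<le> ennreal (W [])" using main by simp
  finally have "measure_pmf.prob (random_play E m C T) {h. \<not> tame q b I h} \<le> W []"
    using W_nonneg by (simp add: ennreal_le_iff)
  then show ?thesis using W0 by simp
qed

section \<open>Greedy plays\<close>

lemma take_play:
  assumes "h \<in> set_pmf (play B C k)" "j \<le> k"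
  shows "take j h \<in> set_pmf (play B C j)"
  using assms
proof (induction k arbitrary: h)
  case (Suc k)
  then obtain h' c where h': "h' \<in> set_pmf (play B C k)" "h = h' @ [(B h', c)]" by auto
  show ?case
  proof (cases "j = Suc k")
    case True
    then show ?thesis using Suc.prems(1) length_play[OF Suc.prems(1)] by simp
  next
    case False
    then show ?thesis using Suc h' length_play[OF h'(1)] by auto
  qed
qed simp

lemma nth_play:
  assumes "h \<in> set_pmf (play B C k)" "i < k"
  shows "fst (h ! i) = B (take i h)" "snd (h ! i) \<in> set_pmf (C (take i h) (B (take i h)))"
proof -
  have "take (Suc i) h \<in> set_pmf (play B C (Suc i))"
    using assms by (intro take_play) auto
  moreover have "take (Suc i) h = take i h @ [h ! i]"
    using assms length_play[OF assms(1)] by (simp add: take_Suc_conv_app_nth)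
  ultimately show "fst (h ! i) = B (take i h)" "snd (h ! i) \<in> set_pmf (C (take i h) (B (take i h)))"
    by auto
qed

lemma map_pmf_take_play: "j \<le> k \<Longrightarrow> map_pmf (take j) (play B C k) = play B C j"
proof (induction k)
  case (Suc k)
  show ?case
  proof (cases "j = Suc k")
    case True
    then have "map_pmf (take j) (play B C (Suc k)) = map_pmf id (play B C (Suc k))"
      using length_play by (intro map_pmf_cong refl) fastforce
    then show ?thesis using True by (simp only: map_pmf_id id_apply)
  next
    case False
    have "map_pmf (take j) (play B C (Suc k)) =
        bind_pmf (play B C k) (\<lambda>h. map_pmf (\<lambda>c. take j (h @ [(B h, c)])) (C h (B h)))"
      by (simp add: map_bind_pmf map_pmf_comp)
    also have "\<dots> = bind_pmf (play B C k) (\<lambda>h. return_pmf (take j h))"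
    proof (intro bind_pmf_cong refl)
      fix h assume "h \<in> set_pmf (play B C k)"
      then have "take j (h @ [(B h, c)]) = take j h" for c
        using length_play[of h B C k] False Suc.prems by simp
      then show "map_pmf (\<lambda>c. take j (h @ [(B h, c)])) (C h (B h)) = return_pmf (take j h)"
        by (simp add: map_pmf_const)
    qed
    also have "\<dots> = map_pmf (take j) (play B C k)" by (simp add: map_pmf_def)
    also have "\<dots> = play B C j" using Suc False by simp
    finally show ?thesis .
  qed
qed simp

lemma free_set_snoc_Some: "free_set \<Gamma> (h @ [(e, Some c)]) = use_color e c (free_set \<Gamma> h)"
  by (auto simp: free_set_def use_color_def fun_eq_iff)

lemma free_set_snoc_None: "free_set \<Gamma> (h @ [(e, None)]) = free_set \<Gamma> h"
  by (auto simp: free_set_def fun_eq_iff)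

lemma use_color_empty: "use_color {} c F = F"
  by (simp add: use_color_def fun_eq_iff)

lemma finite_randomized_greedy: "finite \<Gamma> \<Longrightarrow> finite (set_pmf (randomized_greedy \<Gamma> h e))"
  by (auto simp: randomized_greedy_def Let_def)

lemma randomized_greedy_SomeD:
  assumes "finite \<Gamma>" "Some c \<in> set_pmf (randomized_greedy \<Gamma> h e)"
  shows "c \<in> \<Gamma>" "\<And>v. v \<in> e \<Longrightarrow> c \<in> free_set \<Gamma> h v"
  using assms by (auto simp: randomized_greedy_def Let_def split: if_splits)

lemma randomized_greedy_proper:
  assumes "finite \<Gamma>" "h \<in> set_pmf (play B (randomized_greedy \<Gamma>) k)"
  shows "proper_coloring \<Gamma> h"
  unfolding proper_coloring_def
proof (intro allI impI conjI notI)
  fix i c assume i: "i < length h" "snd (h ! i) = Some c"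
  note len = length_play[OF assms(2)]
  have s: "fst (h ! i) = B (take i h)"
      "Some c \<in> set_pmf (randomized_greedy \<Gamma> (take i h) (B (take i h)))"
    using nth_play[OF assms(2), of i] i len by auto
  show "c \<in> \<Gamma>" using randomized_greedy_SomeD(1)[OF assms(1) s(2)] .
  fix j assume j: "j < i" "fst (h ! i) \<inter> fst (h ! j) \<noteq> {}" "snd (h ! j) = Some c"
  then obtain v where v: "v \<in> fst (h ! i)" "v \<in> fst (h ! j)" by auto
  have "(fst (h ! j), Some c) \<in> set (take i h)"
    using j i by (auto simp: in_set_conv_nth intro!: exI[of _ j] prod_eqI)
  then have "c \<notin> free_set \<Gamma> (take i h) v" using v by (auto simp: free_set_def)
  moreover have "c \<in> free_set \<Gamma> (take i h) v"
    using randomized_greedy_SomeD(2)[OF assms(1) s(2)] v s(1) by simp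
  ultimately show False by simp
qed

section \<open>Edges and slots still to come\<close>

definition unplayed :: "edge set \<Rightarrow> history \<Rightarrow> edge set" where
  "unplayed E h = E - fst ` set h"

lemma unplayed_snoc: "unplayed E (h @ [(e, c)]) = unplayed E h - {e}"
  by (auto simp: unplayed_def)

lemma unplayed_play:
  assumes \<sigma>: "\<sigma> \<in> edge_orders E m" and h: "h \<in> set_pmf (play (obl E \<sigma>) C k)" and E: "{} \<notin> E"
  shows "unplayed E h = {e \<in> E. k < \<sigma> e}"
proof -
  have "fst ` set h = set (map fst h)" by simp
  also have "\<dots> = (\<lambda>i. slot E \<sigma> (Suc i)) ` {..<k}"
    using obl_moves[OF h] by (auto simp: slot_def)
  finally have fst: "fst ` set h = (\<lambda>i. slot E \<sigma> (Suc i)) ` {..<k}" .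
  have "e \<in> fst ` set h \<longleftrightarrow> \<sigma> e \<le> k" if e: "e \<in> E" for e
  proof
    assume "\<sigma> e \<le> k"
    then have "\<sigma> e - 1 < k" "Suc (\<sigma> e - 1) = \<sigma> e"
      using edge_ordersD(2)[OF \<sigma> e] by auto
    then show "e \<in> fst ` set h"
      unfolding fst using slot_at[OF edge_ordersD(1)[OF \<sigma>] e] by (intro image_eqI[of _ _ "\<sigma> e - 1"]) auto
  next
    assume "e \<in> fst ` set h"
    then obtain i where i: "i < k" "e = slot E \<sigma> (Suc i)" unfolding fst by auto
    moreover have "e \<noteq> {}" using E e by auto
    ultimately have "Suc i \<in> \<sigma> ` E" "e = inv_into E \<sigma> (Suc i)" by (auto simp: slot_def split: if_splits)
    then have "\<sigma> e = Suc i" by (simp add: f_inv_into_f)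
    then show "\<sigma> e \<le> k" using i by simp
  qed
  then show ?thesis by (auto simp: unplayed_def not_le[symmetric])
qed

text \<open>Among the slots after move k, those used by \<sigma> carry each remaining edge once and
  all others are null moves; this yields the weights of a uniformly drawn slot.\<close>

lemma sum_slots:
  fixes \<phi> :: "edge \<Rightarrow> real" and k m :: nat
  assumes \<sigma>: "\<sigma> \<in> edge_orders E m" and E: "finite E"
  defines "R \<equiv> {e \<in> E. k < \<sigma> e}"
  shows "(\<Sum>j\<in>{Suc k..m}. \<phi> (slot E \<sigma> j)) = sum \<phi> R + (real (m - k) - real (card R)) * \<phi> {}"
proof -
  have inj: "inj_on \<sigma> R" using edge_ordersD(1)[OF \<sigma>] by (auto simp: R_def intro: inj_on_subset)
  have sub: "\<sigma> ` R \<subseteq> {Suc k..m}" using edge_ordersD(3)[OF \<sigma>] by (auto simp: R_def)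
  have "(\<Sum>j\<in>{Suc k..m}. \<phi> (slot E \<sigma> j)) =
      (\<Sum>j\<in>{Suc k..m} - \<sigma> ` R. \<phi> (slot E \<sigma> j)) + (\<Sum>j\<in>\<sigma> ` R. \<phi> (slot E \<sigma> j))"
    by (rule sum.subset_diff[OF sub]) simp
  also have "(\<Sum>j\<in>\<sigma> ` R. \<phi> (slot E \<sigma> j)) = (\<Sum>e\<in>R. \<phi> (slot E \<sigma> (\<sigma> e)))"
    by (simp add: sum.reindex[OF inj])
  also have "\<dots> = sum \<phi> R"
    using slot_at[OF edge_ordersD(1)[OF \<sigma>]] by (intro sum.cong) (auto simp: R_def)
  also have "(\<Sum>j\<in>{Suc k..m} - \<sigma> ` R. \<phi> (slot E \<sigma> j)) = (\<Sum>j\<in>{Suc k..m} - \<sigma> ` R. \<phi> {})"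
  proof (intro sum.cong refl)
    fix j assume "j \<in> {Suc k..m} - \<sigma> ` R"
    then have "j \<notin> \<sigma> ` E" by (auto simp: R_def)
    then show "\<phi> (slot E \<sigma> j) = \<phi> {}" by (simp add: slot_empty)
  qed
  also have "\<dots> = (real (m - k) - real (card R)) * \<phi> {}"
  proof -
    have "card (\<sigma> ` R) \<le> card {Suc k..m}" by (rule card_mono[OF _ sub]) simp
    then have "card R \<le> m - k" by (simp add: card_image[OF inj])
    moreover have "card ({Suc k..m} - \<sigma> ` R) = m - k - card R"
      by (simp add: card_Diff_subset finite_subset[OF sub] sub card_image[OF inj])
    ultimately show ?thesis by (simp only: sum_constant of_nat_diff)
  qed
  finally show ?thesis by simp
qed

lemma slot_cases:
  assumes \<sigma>: "\<sigma> \<in> edge_orders E m" and "k < j"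
  shows "slot E \<sigma> j \<in> insert {} {e \<in> E. k < \<sigma> e}"
proof (cases "j \<in> \<sigma> ` E")
  case True
  then obtain e where "e \<in> E" "\<sigma> e = j" by auto
  then show ?thesis using slot_at[OF edge_ordersD(1)[OF \<sigma>], of e] assms(2) by auto
qed (simp add: slot_empty)

lemma degree_remove:
  assumes "finite R"
  shows "real (degree (R - {e}) v) = real (degree R v) - (if e \<in> R \<and> v \<in> e then 1 else 0)"
proof (cases "e \<in> R \<and> v \<in> e")
  case True
  have "{e' \<in> R - {e}. v \<in> e'} = {e' \<in> R. v \<in> e'} - {e}" by auto
  moreover have "e \<in> {e' \<in> R. v \<in> e'}" using True by simp
  moreover have "finite {e' \<in> R. v \<in> e'}" using assms by simp
  moreover have "card {e' \<in> R. v \<in> e'} > 0" using calculation card_gt_0_iff by blast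
  ultimately show ?thesis using True by (simp add: degree_def card_Diff_singleton of_nat_diff)
next
  case False
  then have "{e' \<in> R - {e}. v \<in> e'} = {e' \<in> R. v \<in> e'}" by auto
  then show ?thesis using False by (simp add: degree_def)
qed

text \<open>Every move that takes a color away from \<open>admissible g F U\<close> also uses up one of the edges that
  are still to come at some vertex of \<open>U\<close>.\<close>

definition slack :: "nat \<Rightarrow> edge set \<Rightarrow> nat set \<Rightarrow> history \<Rightarrow> real" where
  "slack g E U h = real (card (admissible g (free_set {..<g} h) U)) - (\<Sum>v\<in>U. real (degree (unplayed E h) v))"

lemma slack_snoc:
  assumes E: "finite E" and U: "finite U" and e: "e \<in> insert {} (unplayed E h)"
  shows "slack g E U h \<le> slack g E U (h @ [(e, c)])"
proof -
  have finR: "finite (unplayed E h)" using E by (simp add: unplayed_def)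
  define A where "A = admissible g (free_set {..<g} h) U"
  have finA: "finite A" by (simp add: A_def admissible_def)
  have A': "card A \<le> card (admissible g (free_set {..<g} (h @ [(e, c)])) U) + (if U \<inter> e = {} then 0 else 1)"
  proof (cases c)
    case None
    then show ?thesis by (simp add: free_set_snoc_None A_def)
  next
    case (Some d)
    show ?thesis
    proof (cases "U \<inter> e = {}")
      case True
      then have "admissible g (free_set {..<g} (h @ [(e, c)])) U = A"
        unfolding Some free_set_snoc_Some A_def by (auto simp: admissible_def use_color_def split: if_splits)
      then show ?thesis using True by simp
    next
      case False
      have "A - {d} \<subseteq> admissible g (free_set {..<g} (h @ [(e, c)])) U"
        unfolding Some free_set_snoc_Some A_def by (auto simp: admissible_def use_color_def)
      then have "card (A - {d}) \<le> card (admissible g (free_set {..<g} (h @ [(e, c)])) U)"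
        by (intro card_mono) (auto simp: admissible_def)
      moreover have "card A - 1 \<le> card (A - {d})" using finA by (simp add: card_Diff_singleton_if)
      ultimately show ?thesis using False by simp
    qed
  qed
  have "(\<Sum>v\<in>U. real (degree (unplayed E (h @ [(e, c)])) v)) =
      (\<Sum>v\<in>U. real (degree (unplayed E h) v)) - (\<Sum>v\<in>U. if e \<in> unplayed E h \<and> v \<in> e then 1 else 0)"
    unfolding unplayed_snoc degree_remove[OF finR] sum_subtractf ..
  moreover have "(if U \<inter> e = {} then 0 else 1) \<le> (\<Sum>v\<in>U. if e \<in> unplayed E h \<and> v \<in> e then 1 else 0 :: real)"
  proof (cases "U \<inter> e = {}")
    case False
    then obtain v where v: "v \<in> U" "v \<in> e" by auto
    then have "e \<in> unplayed E h" using e by auto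
    then show ?thesis
      using member_le_sum[of v U "\<lambda>v. if e \<in> unplayed E h \<and> v \<in> e then 1 else 0 :: real"] U v False by simp
  qed (simp add: sum_nonneg)
  moreover have "real (card A) \<le> real (card (admissible g (free_set {..<g} (h @ [(e, c)])) U))
      + (if U \<inter> e = {} then 0 else 1)"
    using A' by (simp split: if_splits)
  ultimately show ?thesis by (simp add: slack_def A_def split: if_splits)
qed

text \<open>Valid along every play and against any Colorer: once the slack of \<open>U\<close> is
  positive, \<open>U\<close> keeps an admissible color for the rest of the game.\<close>

lemma slack_mono:
  assumes E: "finite E" "{} \<notin> E" and U: "finite U" and \<sigma>: "\<sigma> \<in> edge_orders E m"
    and h: "h \<in> set_pmf (play (obl E \<sigma>) C k)" and j: "j \<le> k"
  shows "slack g E U (take j h) \<le> slack g E U h"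
  using h j
proof (induction k arbitrary: h)
  case (Suc k)
  then obtain h' c where h': "h' \<in> set_pmf (play (obl E \<sigma>) C k)" "h = h' @ [(obl E \<sigma> h', c)]" by auto
  note len = length_play[OF h'(1)]
  have "obl E \<sigma> h' \<in> insert {} (unplayed E h')"
    using slot_cases[OF \<sigma>, of k "Suc k"] unfolding unplayed_play[OF \<sigma> h'(1) E(2)] by (simp add: obl_eq_slot len)
  then have step: "slack g E U h' \<le> slack g E U h"
    unfolding h'(2) by (rule slack_snoc[OF E(1) U])
  show ?case
  proof (cases "j = Suc k")
    case True
    then show ?thesis using length_play[OF Suc.prems(1)] by simp
  next
    case False
    then have "slack g E U (take j h') \<le> slack g E U h'" "take j h = take j h'"
      using Suc.IH[OF h'(1)] Suc.prems(2) len h'(2) by auto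
    then show ?thesis using step by simp
  qed
qed simp

section \<open>Tracking the game\<close>

text \<open>The tracked quantities deviate from their ideal values by at most \<open>budget\<close>, which grows by the
  factor \<open>1 + growth / m\<close> per move (twice the largest possible drift) until only a fraction
  \<open>tail\<close> of the moves is left.\<close>

definition tail :: "real \<Rightarrow> real" where
  "tail \<epsilon> = \<epsilon>\<^sup>2 / 64"

definition growth :: "real \<Rightarrow> real" where
  "growth \<epsilon> = 200 / (\<epsilon> ^ 3 * tail \<epsilon>)"

text \<open>The initial budget. Over the game it grows by at most the factor exp (growth
  \<epsilon>), so it ends at no more than \<epsilon>^2 / 32, half of what
  \<open>degree_rest_le\<close> can afford.\<close>

definition base :: "real \<Rightarrow> real" where
  "base \<epsilon> = \<epsilon>\<^sup>2 / 32 * exp (- growth \<epsilon>)"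

text \<open>\<open>Delta_large\<close> keeps the budget at least 1/\<Delta> throughout.
  \<open>m_large\<close> makes growth \<epsilon> / m at most 1/\<Delta>, so that the rise of the
  budget in one move stays within the order of the jumps.\<close>

locale random_order_game =
  fixes \<epsilon> :: real and n \<Delta> m g :: nat and E :: "edge set"
  assumes eps: "0 < \<epsilon>" "\<epsilon> < 1"
    and simple: "simple_graph n E"
    and degree_le: "\<And>v. degree E v \<le> \<Delta>"
    and g_ge: "(1 + \<epsilon>) * real \<Delta> \<le> real g"
    and g_le: "g \<le> 2 * \<Delta>"
    and Delta_large: "1 \<le> base \<epsilon> * real \<Delta>"
    and m_large: "growth \<epsilon> * real \<Delta> \<le> real m"
    and orders: "edge_orders E m \<noteq> {}"
begin

lemma tail_pos: "0 < tail \<epsilon>"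
  using eps by (simp add: tail_def)

lemma growth_ge: "200 \<le> growth \<epsilon>" "200 \<le> growth \<epsilon> * tail \<epsilon>" "growth \<epsilon> * (\<epsilon> ^ 3 * tail \<epsilon>) = 200"
proof -
  have 1: "\<epsilon> ^ 3 \<le> 1" "0 < \<epsilon> ^ 3" using eps by (auto intro: power_le_one)
  have 2: "tail \<epsilon> \<le> 1" using eps power_le_one[of \<epsilon> 2] by (simp add: tail_def)
  show 3: "growth \<epsilon> * (\<epsilon> ^ 3 * tail \<epsilon>) = 200" using 1 tail_pos eps by (simp add: growth_def)
  have "\<epsilon> ^ 3 * tail \<epsilon> \<le> 1" using 1 2 tail_pos by (simp add: mult_le_one)
  then show "200 \<le> growth \<epsilon>"
    unfolding growth_def using 1 tail_pos by (simp add: le_divide_eq)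
  have "growth \<epsilon> * tail \<epsilon> = 200 / \<epsilon> ^ 3" using tail_pos eps by (simp add: growth_def)
  then show "200 \<le> growth \<epsilon> * tail \<epsilon>" using 1 by (simp add: le_divide_eq)
qed

lemma base_bounds: "0 < base \<epsilon>" "base \<epsilon> \<le> \<epsilon>\<^sup>2 / 32"
proof -
  show "0 < base \<epsilon>" using eps by (simp add: base_def)
  have "exp (- growth \<epsilon>) \<le> 1" using growth_ge by simp
  then have "\<epsilon>\<^sup>2 / 32 * exp (- growth \<epsilon>) \<le> \<epsilon>\<^sup>2 / 32 * 1" by (intro mult_left_mono) auto
  then show "base \<epsilon> \<le> \<epsilon>\<^sup>2 / 32" by (simp add: base_def)
qed

lemma Delta_pos: "0 < real \<Delta>"
  using Delta_large by (cases "\<Delta> = 0") auto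

lemma m_pos: "0 < real m"
proof -
  have "0 < growth \<epsilon> * real \<Delta>" using growth_ge Delta_pos by (intro mult_pos_pos) auto
  then show ?thesis using m_large by linarith
qed

lemma growth_div_le: "growth \<epsilon> / real m \<le> 1 / real \<Delta>"
  using m_large m_pos Delta_pos by (simp add: field_simps)

lemma eps_Delta: "2 \<le> \<epsilon> * real \<Delta>"
proof -
  have "\<epsilon>\<^sup>2 \<le> \<epsilon>" using eps power_decreasing[of 1 2 \<epsilon>] by simp
  then have "base \<epsilon> \<le> \<epsilon> / 2" using base_bounds eps by simp
  then have "base \<epsilon> * real \<Delta> \<le> \<epsilon> / 2 * real \<Delta>" by (intro mult_right_mono) auto
  then show ?thesis using Delta_large by simp
qed

definition budget :: "nat \<Rightarrow> real" where
  "budget k = base \<epsilon> * (1 + growth \<epsilon> / real m) ^ k"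

lemma budget_Suc: "budget (Suc k) - budget k = growth \<epsilon> / real m * budget k"
  by (simp add: budget_def algebra_simps)

lemma budget_ge: "base \<epsilon> \<le> budget k"
proof -
  have "1 \<le> (1 + growth \<epsilon> / real m) ^ k" using growth_ge m_pos by (intro one_le_power) auto
  then show ?thesis using base_bounds by (simp add: budget_def)
qed

lemma budget_le:
  assumes "k \<le> m"
  shows "budget k \<le> \<epsilon>\<^sup>2 / 32"
proof -
  have "(1 + growth \<epsilon> / real m) ^ k \<le> exp (growth \<epsilon> / real m) ^ k"
    using growth_ge m_pos by (intro power_mono) (auto simp: exp_ge_add_one_self)
  also have "\<dots> = exp (growth \<epsilon> * (real k / real m))"
    by (simp add: exp_of_nat_mult[symmetric] mult.commute)
  also have "\<dots> \<le> exp (growth \<epsilon> * 1)"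
    using growth_ge assms m_pos by (subst exp_le_cancel_iff, intro mult_left_mono) auto
  finally have "budget k \<le> base \<epsilon> * exp (growth \<epsilon>)"
    using base_bounds by (simp add: budget_def)
  then show ?thesis by (simp add: base_def mult.assoc exp_add[symmetric])
qed

lemma budget_le_half: "k \<le> m \<Longrightarrow> budget k \<le> 1 / 2"
  using budget_le[of k] eps power_le_one[of \<epsilon> 2] by simp

definition horizon :: nat where
  "horizon = nat \<lfloor>(1 - tail \<epsilon>) * real m\<rfloor>"

lemma tail_lt_1: "tail \<epsilon> < 1"
  using eps power_le_one[of \<epsilon> 2] by (simp add: tail_def)

lemma horizon_bounds:
  "horizon \<le> m" "k < horizon \<Longrightarrow> tail \<epsilon> * real m \<le> real (m - k)"
  "real m - real horizon \<le> 2 * tail \<epsilon> * real m"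
proof -
  have nn: "0 \<le> (1 - tail \<epsilon>) * real m" using tail_lt_1 by simp
  then have h: "real horizon = of_int \<lfloor>(1 - tail \<epsilon>) * real m\<rfloor>" by (simp add: horizon_def)
  have le: "real horizon \<le> (1 - tail \<epsilon>) * real m" unfolding h by simp
  also have "\<dots> \<le> 1 * real m" using tail_pos by (intro mult_right_mono) auto
  finally show hm: "horizon \<le> m" by simp
  show "tail \<epsilon> * real m \<le> real (m - k)" if "k < horizon"
  proof -
    have "real k \<le> (1 - tail \<epsilon>) * real m" using that le by simp
    then show ?thesis using that hm by (simp add: of_nat_diff algebra_simps)
  qed
  have "(1 - tail \<epsilon>) * real m < real horizon + 1" unfolding h by linarith
  \<comment> \<open>Rounding the horizon down costs less than one move, and one move is at most a
    further fraction \<open>tail \<epsilon>\<close> of the game; hence the factor 2.\<close>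
  moreover have "1 \<le> tail \<epsilon> * real m"
  proof -
    have "1 \<le> real \<Delta>" using Delta_pos by simp
    have "1 * 1 \<le> (growth \<epsilon> * tail \<epsilon>) * real \<Delta>"
      using growth_ge \<open>1 \<le> real \<Delta>\<close> by (intro mult_mono) auto
    also have "\<dots> = tail \<epsilon> * (growth \<epsilon> * real \<Delta>)" by simp
    also have "\<dots> \<le> tail \<epsilon> * real m" using m_large tail_pos by (intro mult_left_mono) auto
    finally show ?thesis by simp
  qed
  ultimately show "real m - real horizon \<le> 2 * tail \<epsilon> * real m" by (simp add: algebra_simps)
qed

lemma edgeD: "e \<in> E \<Longrightarrow> e \<subseteq> {..<n} \<and> card e = 2"
  using simple by (simp add: simple_graph_def)

lemma empty_notin: "{} \<notin> E"
  using edgeD[of "{}"] by auto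

lemma finite_E: "finite E"
  using edgeD by (intro finite_subset[of E "Pow {..<n}"]) auto

abbreviation free :: "history \<Rightarrow> nat \<Rightarrow> color set" where
  "free h \<equiv> free_set {..<g} h"

abbreviation rest :: "history \<Rightarrow> edge set" where
  "rest h \<equiv> unplayed E h"

abbreviation greedy :: colorer where
  "greedy \<equiv> randomized_greedy {..<g}"

abbreviation target :: "nat \<Rightarrow> nat \<Rightarrow> real" where
  "target k v \<equiv> (1 - real k / real m) * (real (degree E v) / real \<Delta>)"

definition deviation :: "(nat \<times> nat) + (nat \<times> color option) \<Rightarrow> history \<Rightarrow> real" where
  "deviation i h = (case i of
     Inl (u, v) \<Rightarrow> overlap g (free h u) (free h v) - 1
   | Inr (v, x) \<Rightarrow> load g (free h) (rest h) v x / real \<Delta> - target (length h) v)"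

text \<open>The pairs u = v must stay out: \<open>overlap g S S\<close> equals g / |S|, which moves
  away from 1 as colors are used.\<close>

definition indices :: "((nat \<times> nat) + (nat \<times> color option)) set" where
  "indices = Inl ` {(u, v). u < n \<and> v < n \<and> u \<noteq> v} \<union> Inr ` ({..<n} \<times> insert None (Some ` {..<g}))"

abbreviation good :: "history \<Rightarrow> bool" where
  "good \<equiv> tame deviation budget indices"

lemma finite_indices: "finite indices"
proof -
  have "finite {(u, v). u < n \<and> v < n \<and> u \<noteq> v}"
    by (rule finite_subset[of _ "{..<n} \<times> {..<n}"]) auto
  then show ?thesis by (simp add: indices_def)
qed

lemma card_indices: "card indices \<le> n * n + n * (g + 1)"
proof -
  have "card indices \<le> card {(u, v). u < n \<and> v < n \<and> u \<noteq> v} + card ({..<n} \<times> insert None (Some ` {..<g}))"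
    unfolding indices_def
    by (intro order_trans[OF card_Un_le] add_mono card_image_le)
      (auto intro: finite_subset[of _ "{..<n} \<times> {..<n}"])
  moreover have "card {(u, v). u < n \<and> v < n \<and> u \<noteq> v} \<le> card ({..<n} \<times> {..<n})"
    by (intro card_mono) auto
  moreover have "card (insert None (Some ` {..<g})) = g + 1"
    by (simp add: card_insert_if card_image image_iff)
  ultimately show ?thesis by (simp add: card_cartesian_product)
qed

lemma g_pos: "0 < real g"
proof -
  have "0 < (1 + \<epsilon>) * real \<Delta>" using eps Delta_pos by (intro mult_pos_pos) auto
  then show ?thesis using g_ge by linarith
qed

lemma deviation_Nil: "i \<in> indices \<Longrightarrow> deviation i [] = 0"
proof -
  assume i: "i \<in> indices"
  have F: "free [] = (\<lambda>_. {..<g})" by (auto simp: free_set_def)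
  have w: "weight g (free []) x w = 1" if "x \<in> insert None (Some ` {..<g})" for x w
    using that g_pos by (auto simp: F weight_def share_def)
  show ?thesis
  proof (cases i)
    case (Inl p)
    then show ?thesis using g_pos by (cases p) (simp add: deviation_def F overlap_def)
  next
    case (Inr p)
    then obtain v x where vx: "i = Inr (v, x)" "x \<in> insert None (Some ` {..<g})"
      using i by (cases p) (auto simp: indices_def)
    have "load g (free []) (rest []) v x = real (card (nbrs E v))"
      unfolding load_def w[OF vx(2)] by (simp add: unplayed_def)
    also have "card (nbrs E v) = degree E v" by (rule card_nbrs) (use edgeD in auto)
    finally show ?thesis using vx(1) by (simp add: deviation_def)
  qed
qed

text \<open>Certain, for every Colorer: an edge at v costs at most one free color and exactly one
  remaining edge, so the initial surplus g - degree E v \<ge> \<epsilon>\<Delta> is never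
  lost.\<close>

lemma card_free_ge:
  assumes \<sigma>: "\<sigma> \<in> edge_orders E m" and h: "h \<in> set_pmf (play (obl E \<sigma>) C k)"
  shows "\<epsilon> * real \<Delta> \<le> real (card (free h v))"
proof -
  have "slack g E {v} (take 0 h) \<le> slack g E {v} h"
    by (rule slack_mono[OF finite_E empty_notin _ \<sigma> h]) auto
  moreover have "admissible g (free h) {v} = free h v"
    by (auto simp: admissible_def free_set_def)
  moreover have "admissible g (free []) {v} = {..<g}"
    by (auto simp: admissible_def free_set_def)
  moreover have "rest [] = E" by (simp add: unplayed_def)
  ultimately have "real g - real (degree E v) \<le> real (card (free h v)) - real (degree (rest h) v)"
    by (simp add: slack_def)
  then show ?thesis using g_ge degree_le[of v] by (simp add: algebra_simps)
qed

lemma tracked: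
  assumes \<sigma>: "\<sigma> \<in> edge_orders E m" and h: "h \<in> set_pmf (play (obl E \<sigma>) C k)"
    and good: "good h" and k: "k \<le> m"
  shows "tracked_state \<epsilon> (budget k) \<Delta> g {..<n} (free h) (rest h) (target k)"
proof
  note len = length_play[OF h]
  have dev: "\<bar>deviation i h\<bar> \<le> budget k" if "i \<in> indices" for i
    using good that len by (auto simp: tame_def dest!: spec[of _ k])
  show "0 < \<epsilon>" "\<epsilon> < 1" "2 \<le> \<epsilon> * real \<Delta>" "g \<le> 2 * \<Delta>" by (fact eps eps_Delta g_le)+
  show "budget k \<le> 1 / 2" by (rule budget_le_half[OF k])
  have "base \<epsilon> * real \<Delta> \<le> budget k * real \<Delta>" using budget_ge by (intro mult_right_mono) auto
  then show "1 \<le> budget k * real \<Delta>" using Delta_large by linarith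
  show "finite (rest h)" using finite_E by (simp add: unplayed_def)
  show "e \<subseteq> {..<n} \<and> card e = 2" if "e \<in> rest h" for e
    using that edgeD by (auto simp: unplayed_def)
  show "degree (rest h) v \<le> \<Delta>" for v
  proof -
    have "degree (rest h) v \<le> degree E v"
      unfolding degree_def using finite_E by (intro card_mono) (auto simp: unplayed_def)
    then show ?thesis using degree_le[of v] by simp
  qed
  show "free h v \<subseteq> {..<g}" for v by (auto simp: free_set_def)
  show "\<epsilon> * real \<Delta> \<le> real (card (free h v))" for v by (rule card_free_ge[OF \<sigma> h])
  show "\<bar>overlap g (free h u) (free h v) - 1\<bar> \<le> budget k" if "u \<in> {..<n}" "v \<in> {..<n}" "u \<noteq> v" for u v
    using dev[of "Inl (u, v)"] that by (auto simp: indices_def deviation_def)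
  show "\<bar>load g (free h) (rest h) v x / real \<Delta> - target k v\<bar> \<le> budget k"
    if "v \<in> {..<n}" "x \<in> insert None (Some ` {..<g})" for v x
    using dev[of "Inr (v, x)"] that by (auto simp: indices_def deviation_def len)
qed

end

section \<open>One random move of the game\<close>

context random_order_game
begin

text \<open>The resampled slot holds each remaining edge with probability 1/(m - k) and is null
  otherwise; given the edge, the greedy color is uniform over the admissible ones, so
  \<open>mean\<close> is the conditional expectation. The hypothesis \<open>adm\<close> excludes the
  outcome \<open>None\<close>.\<close>

lemma expectation_next_move:
  fixes f :: "edge \<times> color option \<Rightarrow> real"
  assumes \<sigma>: "\<sigma> \<in> edge_orders E m" and h: "h \<in> set_pmf (play (obl E \<sigma>) greedy k)"
    and k: "k < m" and adm: "\<And>e. e \<in> rest h \<Longrightarrow> admissible g (free h) e \<noteq> {}"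
  shows "measure_pmf.expectation (next_move E m greedy \<sigma> h) f =
    ((\<Sum>e\<in>rest h. mean (admissible g (free h) e) (\<lambda>c. f (e, Some c)))
      + (real (m - k) - real (card (rest h))) * mean {..<g} (\<lambda>c. f ({}, Some c))) / real (m - k)"
proof -
  note len = length_play[OF h]
  note rest = unplayed_play[OF \<sigma> h empty_notin]
  define \<phi> where "\<phi> = (\<lambda>e. mean (admissible g (free h) e) (\<lambda>c. f (e, Some c)))"
  have adm0: "admissible g (free h) {} = {..<g}" by (simp add: admissible_def)
  have "g \<noteq> 0" using g_pos by auto
  then have ne: "admissible g (free h) (slot E \<sigma> j) \<noteq> {}" if "j \<in> {Suc k..m}" for j
    using slot_cases[OF \<sigma>, of k j] that adm unfolding rest[symmetric] by (auto simp: adm0)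
  have greedy: "measure_pmf.expectation (map_pmf (Pair e) (greedy h e)) f = mean (admissible g (free h) e) (\<lambda>c. f (e, Some c))"
    if "admissible g (free h) e \<noteq> {}" for e
  proof -
    have "greedy h e = map_pmf Some (pmf_of_set (admissible g (free h) e))"
      using that by (simp add: randomized_greedy_def admissible_def Let_def)
    then show ?thesis
      using that by (simp add: integral_pmf_of_set admissible_def mean_def)
  qed
  have "measure_pmf.expectation (next_move E m greedy \<sigma> h) f =
      (\<Sum>j\<in>{Suc k..m}. measure_pmf.expectation (map_pmf (Pair (slot E \<sigma> j)) (greedy h (slot E \<sigma> j))) f
        / real (m - k))"
    unfolding next_move_def len using k
    by (subst pmf_expectation_bind_pmf_of_set) (auto simp: finite_randomized_greedy divide_inverse mult.commute)
  also have "\<dots> = (\<Sum>j\<in>{Suc k..m}. \<phi> (slot E \<sigma> j)) / real (m - k)"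
    unfolding sum_divide_distrib[symmetric] \<phi>_def using greedy[OF ne]
    by (intro arg_cong2[of _ _ _ _ "(/)"] sum.cong refl) auto
  also have "(\<Sum>j\<in>{Suc k..m}. \<phi> (slot E \<sigma> j)) =
      sum \<phi> (rest h) + (real (m - k) - real (card (rest h))) * \<phi> {}"
    unfolding rest by (rule sum_slots[OF \<sigma> finite_E])
  finally show ?thesis by (simp add: \<phi>_def adm0)
qed

lemma target_Suc: "target (Suc k) v = target k v - real (degree E v) / (real \<Delta> * real m)"
  using m_pos Delta_pos by (simp add: field_simps)

text \<open>A common form for both families: \<open>st\<close> is the effect of the played edge, s
  the fall of the target, which occurs on null moves as well and is 0 for overlaps. For loads, (m -
  k) s is the current target, the counterpart of \<open>\<theta> v\<close> in
  \<open>load_drift\<close>.\<close>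

lemma deviation_step:
  assumes \<sigma>: "\<sigma> \<in> edge_orders E m" and h: "h \<in> set_pmf (play (obl E \<sigma>) greedy k)"
    and good: "good h" and k: "k < m" and i: "i \<in> indices"
  obtains st :: "edge \<Rightarrow> color \<Rightarrow> real" and s :: real where
    "\<And>e c. e \<in> rest h \<Longrightarrow> deviation i (h @ [(e, Some c)]) - deviation i h = st e c + s"
    "\<And>c. deviation i (h @ [({}, Some c)]) - deviation i h = s"
    "0 \<le> s" "s \<le> 1 / real m"
    "\<bar>(\<Sum>e\<in>rest h. mean (admissible g (free h) e) (st e)) + real (m - k) * s\<bar> \<le> 100 * budget k / \<epsilon> ^ 3"
    "(\<Sum>e\<in>rest h. mean (admissible g (free h) e) (\<lambda>c. \<bar>st e c\<bar>)) \<le> 24 / \<epsilon> ^ 3"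
    "\<And>e c. e \<in> rest h \<Longrightarrow> c \<in> admissible g (free h) e \<Longrightarrow> \<bar>st e c\<bar> \<le> 12 / (\<epsilon>\<^sup>2 * real \<Delta>)"
proof -
  interpret S: tracked_state \<epsilon> "budget k" \<Delta> g "{..<n}" "free h" "rest h" "target k"
    using k by (intro tracked[OF \<sigma> h good]) simp
  note len = length_play[OF h]
  have null: "rest (h @ [({}, Some c)]) = rest h" "free (h @ [({}, Some c)]) = free h" for c
    using empty_notin by (auto simp: unplayed_snoc free_set_snoc_Some use_color_empty unplayed_def)
  show ?thesis
  proof (cases i)
    case (Inl p)
    then obtain u v where uv: "i = Inl (u, v)" "u < n" "v < n" "u \<noteq> v"
      using i by (auto simp: indices_def)
    show ?thesis
    proof (rule that[of "S.overlap_step u v" 0])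
      show "\<bar>(\<Sum>e\<in>rest h. mean (admissible g (free h) e) (S.overlap_step u v e)) + real (m - k) * 0\<bar>
          \<le> 100 * budget k / \<epsilon> ^ 3"
        using S.overlap_drift[of u v] uv by simp
    qed (use uv S.overlap_variation[of u v] S.abs_overlap_step_le null in
        \<open>auto simp: deviation_def free_set_snoc_Some S.overlap_step_def\<close>)
  next
    case (Inr p)
    then obtain v x where vx: "i = Inr (v, x)" "v < n" "x \<in> insert None (Some ` {..<g})"
      using i by (auto simp: indices_def)
    define s where "s = real (degree E v) / (real \<Delta> * real m)"
    have target: "target (Suc k) v = target k v - s" unfolding s_def by (rule target_Suc)
    show ?thesis
    proof (rule that[of "S.load_step v x" s])
      show "deviation i (h @ [(e, Some c)]) - deviation i h = S.load_step v x e c + s"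
        if "e \<in> rest h" for e c
        using target by (simp add: deviation_def vx(1) len S.load_step_def free_set_snoc_Some unplayed_snoc diff_divide_distrib)
      show "deviation i (h @ [({}, Some c)]) - deviation i h = s" for c
        using target by (simp add: deviation_def vx(1) len null)
      show "0 \<le> s" by (simp add: s_def)
      have "s \<le> real \<Delta> / (real \<Delta> * real m)"
        unfolding s_def using degree_le[of v] by (intro divide_right_mono) auto
      then show "s \<le> 1 / real m" using Delta_pos by simp
      have "real (m - k) * s = target k v"
        using k m_pos Delta_pos by (simp add: s_def of_nat_diff field_simps)
      then show "\<bar>(\<Sum>e\<in>rest h. mean (admissible g (free h) e) (S.load_step v x e)) + real (m - k) * s\<bar>
          \<le> 100 * budget k / \<epsilon> ^ 3"
        using S.load_drift[of v x] vx by simp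
    qed (use S.load_variation S.abs_load_step_le in auto)
  qed
qed

text \<open>With L = 13 / (\<epsilon>^2 \<Delta>), the jump bound of the compensated deviation,
  \<open>rate * L\<close> is \<open>base \<epsilon> / 2\<close>. As the mean absolute change is at
  most growth \<epsilon> / m, the quadratic term costs at most half of base \<epsilon> * growth
  \<epsilon> / m, the smallest rise of the budget.\<close>

definition rate :: real where
  "rate = base \<epsilon> * \<epsilon>\<^sup>2 * real \<Delta> / 26"

lemma exponential_step:
  assumes k: "k < horizon" and \<sigma>: "\<sigma> \<in> edge_orders E m"
    and h: "h \<in> set_pmf (play (obl E \<sigma>) greedy k)"
    and good: "good h" and i: "i \<in> indices" and z: "z \<in> {1, -1 :: real}"
  shows "measure_pmf.expectation (next_move E m greedy \<sigma> h)
    (\<lambda>x. exp (rate * (z * (deviation i (h @ [x]) - deviation i h) - (budget (Suc k) - budget k)))) \<le> 1"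
proof -
  note len = length_play[OF h]
  have km: "k < m" using k horizon_bounds(1) by simp
  interpret S: tracked_state \<epsilon> "budget k" \<Delta> g "{..<n}" "free h" "rest h" "target k"
    using km by (intro tracked[OF \<sigma> h good]) simp
  obtain st s where
    step: "\<And>e c. e \<in> rest h \<Longrightarrow> deviation i (h @ [(e, Some c)]) - deviation i h = st e c + s"
    and null: "\<And>c. deviation i (h @ [({}, Some c)]) - deviation i h = s"
    and s: "0 \<le> s" "s \<le> 1 / real m"
    and drift: "\<bar>(\<Sum>e\<in>rest h. mean (admissible g (free h) e) (st e)) + real (m - k) * s\<bar> \<le> 100 * budget k / \<epsilon> ^ 3"
    and var: "(\<Sum>e\<in>rest h. mean (admissible g (free h) e) (\<lambda>c. \<bar>st e c\<bar>)) \<le> 24 / \<epsilon> ^ 3"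
    and jump: "\<And>e c. e \<in> rest h \<Longrightarrow> c \<in> admissible g (free h) e \<Longrightarrow> \<bar>st e c\<bar> \<le> 12 / (\<epsilon>\<^sup>2 * real \<Delta>)"
    using deviation_step[OF \<sigma> h good km i] by blast
  define p where "p = next_move E m greedy \<sigma> h"
  define D where "D = (\<lambda>x. deviation i (h @ [x]) - deviation i h)"
  define w where "w = growth \<epsilon> / real m * budget k"
  define r where "r = real (m - k)"
  have r: "0 < r" "tail \<epsilon> * real m \<le> r" using km horizon_bounds(2)[OF k] by (auto simp: r_def)
  have fin: "finite (set_pmf p)"
    using km by (simp add: p_def next_move_def len finite_randomized_greedy)
  note int = integrable_measure_pmf_finite[OF fin]
  have expect: "measure_pmf.expectation p f =
      ((\<Sum>e\<in>rest h. mean (admissible g (free h) e) (\<lambda>c. f (e, Some c)))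
        + (r - real (card (rest h))) * mean {..<g} (\<lambda>c. f ({}, Some c))) / r" for f
    unfolding p_def r_def by (rule expectation_next_move[OF \<sigma> h km S.admissible_nonempty])
  have gpos: "{..<g} \<noteq> {}" "finite {..<g}" using g_pos by auto
  have mean_null: "mean {..<g} (\<lambda>c. D ({}, Some c)) = s"
    using mean_const[OF gpos(2,1), of s] by (simp add: D_def null)
  have mean_step: "mean (admissible g (free h) e) (\<lambda>c. D (e, Some c)) = mean (admissible g (free h) e) (st e) + s"
    if "e \<in> rest h" for e
  proof -
    have "mean (admissible g (free h) e) (\<lambda>c. D (e, Some c)) = mean (admissible g (free h) e) (\<lambda>c. st e c + s)"
      using step[OF that] by (simp add: D_def)
    also have "\<dots> = mean (admissible g (free h) e) (st e) + mean (admissible g (free h) e) (\<lambda>_. s)"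
      by (simp add: mean_def sum.distrib add_divide_distrib)
    finally show ?thesis
      using mean_const[OF S.finite_admissible S.admissible_nonempty[OF that]] by simp
  qed
  have "measure_pmf.expectation p D =
      ((\<Sum>e\<in>rest h. mean (admissible g (free h) e) (st e) + s) + (r - real (card (rest h))) * s) / r"
    by (simp add: expect[of D] mean_step mean_null)
  also have "\<dots> = ((\<Sum>e\<in>rest h. mean (admissible g (free h) e) (st e)) + r * s) / r"
    by (simp add: sum.distrib algebra_simps)
  finally have "\<bar>measure_pmf.expectation p D\<bar> =
      \<bar>(\<Sum>e\<in>rest h. mean (admissible g (free h) e) (st e)) + r * s\<bar> / r"
    using r(1) by (simp add: abs_divide)
  also have "\<dots> \<le> 100 * budget k / \<epsilon> ^ 3 / r"
    using drift r(1) unfolding r_def by (rule divide_right_mono[OF _ less_imp_le])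
  \<comment> \<open>Before the horizon at least tail \<epsilon> * m slots remain. By the choice of
    \<open>growth\<close> the drift uses up only half of the budget's rise w; the other half pays
    for the fluctuations.\<close>
  also have "\<dots> \<le> 100 * budget k / \<epsilon> ^ 3 / (tail \<epsilon> * real m)"
    using r tail_pos m_pos S.B_nonneg eps by (intro divide_left_mono) auto
  also have "\<dots> = w / 2"
    by (simp add: w_def growth_def field_simps)
  finally have ED: "\<bar>measure_pmf.expectation p D\<bar> \<le> w / 2" .
  have mean_abs_step: "mean (admissible g (free h) e) (\<lambda>c. \<bar>D (e, Some c)\<bar>) \<le>
      mean (admissible g (free h) e) (\<lambda>c. \<bar>st e c\<bar>) + s" if "e \<in> rest h" for e
  proof -
    have "mean (admissible g (free h) e) (\<lambda>c. \<bar>D (e, Some c)\<bar>) \<le> mean (admissible g (free h) e) (\<lambda>c. \<bar>st e c\<bar> + s)"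
      using step[OF that] s by (intro mean_mono) (simp add: D_def)
    also have "\<dots> = mean (admissible g (free h) e) (\<lambda>c. \<bar>st e c\<bar>) + mean (admissible g (free h) e) (\<lambda>_. s)"
      by (simp add: mean_def sum.distrib add_divide_distrib)
    finally show ?thesis
      using mean_const[OF S.finite_admissible S.admissible_nonempty[OF that]] by simp
  qed
  have "measure_pmf.expectation p (\<lambda>x. \<bar>D x\<bar>) =
      ((\<Sum>e\<in>rest h. mean (admissible g (free h) e) (\<lambda>c. \<bar>D (e, Some c)\<bar>)) + (r - real (card (rest h))) * s) / r"
    unfolding expect using null s mean_const[OF gpos(2,1), of s] by (simp add: D_def)
  also have "\<dots> \<le> ((\<Sum>e\<in>rest h. mean (admissible g (free h) e) (\<lambda>c. \<bar>st e c\<bar>) + s) + (r - real (card (rest h))) * s) / r"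
    using r mean_abs_step by (intro divide_right_mono add_right_mono sum_mono) auto
  also have "\<dots> = (\<Sum>e\<in>rest h. mean (admissible g (free h) e) (\<lambda>c. \<bar>st e c\<bar>)) / r + s"
    using r by (simp add: sum.distrib field_simps)
  also have "\<dots> \<le> 24 / \<epsilon> ^ 3 / (tail \<epsilon> * real m) + 1 / real m"
    using var r s tail_pos m_pos eps by (intro add_mono frac_le) auto
  also have "24 / \<epsilon> ^ 3 / (tail \<epsilon> * real m) = 24 / 200 * (growth \<epsilon> / real m)"
    by (simp add: growth_def field_simps)
  finally have AD: "measure_pmf.expectation p (\<lambda>x. \<bar>D x\<bar>) \<le> 24 / 200 * (growth \<epsilon> / real m) + 1 / real m" .
  have w: "0 \<le> w" "w \<le> growth \<epsilon> / real m * (1 / 2)" "base \<epsilon> * growth \<epsilon> / real m \<le> w"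
    using S.B_nonneg budget_le_half[of k] budget_ge[of k] growth_ge km m_pos
    by (auto simp: w_def mult.commute[of "base \<epsilon>"] simp del: times_divide_eq_right intro!: mult_left_mono divide_right_mono)
  define a where "a = growth \<epsilon> / real m"
  have inv_m: "1 / real m \<le> a / 200"
    using growth_ge m_pos by (simp add: a_def field_simps)
  have w': "w \<le> a / 2" using w(2) by (simp add: a_def)
  \<comment> \<open>12 comes from the jump of the tracked quantity, 1 from the falling target and
    the rising budget, since s + w \<le> growth \<epsilon> / m \<le> 1/\<Delta>.\<close>
  define L where "L = 13 / (\<epsilon>\<^sup>2 * real \<Delta>)"
  define Y where "Y = (\<lambda>x. z * D x - w)"
  have rL: "rate * L = base \<epsilon> / 2"
    using eps Delta_pos by (simp add: rate_def L_def field_simps)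
  have "measure_pmf.expectation p (\<lambda>x. exp (rate * Y x)) \<le> 1"
  proof (rule exp_moment_le_1[OF fin, of Y L "base \<epsilon> * growth \<epsilon> / real m / 2" "growth \<epsilon> / real m"])
    fix x assume "x \<in> set_pmf p"
    then obtain j where j: "j \<in> {Suc k..m}" "fst x = slot E \<sigma> j" "snd x \<in> set_pmf (greedy h (slot E \<sigma> j))"
      using km by (auto simp: p_def next_move_def len)
    have slot: "fst x \<in> insert {} (rest h)"
      using slot_cases[OF \<sigma>, of k j] j(1,2) unfolding unplayed_play[OF \<sigma> h empty_notin] by simp
    have adm: "admissible g (free h) (fst x) \<noteq> {}"
      using slot S.admissible_nonempty gpos by (auto simp: admissible_def)
    then have "snd x \<in> Some ` admissible g (free h) (fst x)"
      using j(2,3) by (auto simp: randomized_greedy_def admissible_def Let_def split: if_splits)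
    then obtain c where c: "snd x = Some c" "c \<in> admissible g (free h) (fst x)" by auto
    have "x = (fst x, Some c)" using c(1) by (simp add: prod_eq_iff)
    then have "\<bar>D x\<bar> \<le> 12 / (\<epsilon>\<^sup>2 * real \<Delta>) + s"
    proof (cases "fst x = {}")
      case True
      then have "D x = s" using null[of c] \<open>x = (fst x, Some c)\<close> by (simp add: D_def)
      then show ?thesis using s by simp
    next
      case False
      then have e: "fst x \<in> rest h" using slot by simp
      have "D x = st (fst x) c + s" using step[OF e, of c] \<open>x = (fst x, Some c)\<close> by (simp add: D_def)
      then show ?thesis using jump[OF e c(2)] s by linarith
    qed
    then have "\<bar>D x\<bar> + w \<le> 12 / (\<epsilon>\<^sup>2 * real \<Delta>) + (s + w)" by simp
    also have "s + w \<le> a" using s(2) w(1) w' inv_m by linarith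
    also have "\<dots> \<le> 1 / real \<Delta>" unfolding a_def by (rule growth_div_le)
    also have "\<dots> \<le> 1 / (\<epsilon>\<^sup>2 * real \<Delta>)"
      using eps Delta_pos power_le_one[of \<epsilon> 2] by (intro divide_left_mono) auto
    also have "12 / (\<epsilon>\<^sup>2 * real \<Delta>) + 1 / (\<epsilon>\<^sup>2 * real \<Delta>) = L"
      by (simp add: L_def add_divide_distrib[symmetric])
    finally show "\<bar>Y x\<bar> \<le> L" using z w(1) by (auto simp: Y_def)
  next
    have "measure_pmf.expectation p Y = z * measure_pmf.expectation p D - w"
      by (simp add: Y_def int)
    then show "measure_pmf.expectation p Y \<le> - (base \<epsilon> * growth \<epsilon> / real m / 2)"
      using ED w(3) z by auto
  next
    have "measure_pmf.expectation p (\<lambda>x. \<bar>Y x\<bar>) \<le> measure_pmf.expectation p (\<lambda>x. \<bar>D x\<bar> + w)"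
      using z w(1) by (intro integral_mono int) (auto simp: Y_def)
    also have "\<dots> = measure_pmf.expectation p (\<lambda>x. \<bar>D x\<bar>) + w" by (simp add: int)
    also have "\<dots> \<le> growth \<epsilon> / real m"
    proof -
      have "measure_pmf.expectation p (\<lambda>x. \<bar>D x\<bar>) \<le> 24 / 200 * a + 1 / real m"
        using AD by (simp only: a_def)
      then show ?thesis using w(1) w' inv_m unfolding a_def[symmetric] by linarith
    qed
    finally show "measure_pmf.expectation p (\<lambda>x. \<bar>Y x\<bar>) \<le> growth \<epsilon> / real m" .
  next
    show "0 \<le> rate" using base_bounds by (simp add: rate_def)
    have "base \<epsilon> \<le> 1" using base_bounds eps power_le_one[of \<epsilon> 2] by simp
    then show "rate * L \<le> 1" by (simp add: rL)
    show "rate * L * (growth \<epsilon> / real m) \<le> base \<epsilon> * growth \<epsilon> / real m / 2" by (simp add: rL)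
    show "0 \<le> L" by (simp add: L_def)
  qed
  then show ?thesis by (simp add: p_def Y_def D_def w_def budget_Suc)
qed

section \<open>From tracked deviations to a win\<close>

lemma prob_not_good_le:
  "measure_pmf.prob (random_play E m greedy horizon) {h. \<not> good h} \<le>
    2 * real (n * n + n * (g + 1)) * exp (- ((base \<epsilon>)\<^sup>2 * \<epsilon>\<^sup>2 / 26) * real \<Delta>)"
proof -
  have b0: "budget 0 = base \<epsilon>" by (simp add: budget_def)
  have "measure_pmf.prob (random_play E m greedy horizon) {h. \<not> good h} \<le>
      2 * real (card indices) * exp (- rate * budget 0)"
  proof (rule prob_not_tame_le[OF finite_E orders horizon_bounds(1) finite_indices])
    show "0 \<le> rate" using base_bounds by (simp add: rate_def)
    show "0 \<le> budget 0" using base_bounds b0 by simp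
  qed (use exponential_step deviation_Nil finite_randomized_greedy in auto)
  also have "\<dots> \<le> 2 * real (n * n + n * (g + 1)) * exp (- rate * budget 0)"
    using card_indices by (intro mult_right_mono mult_left_mono) (auto simp only: of_nat_le_iff exp_ge_zero)
  also have "- rate * budget 0 = - ((base \<epsilon>)\<^sup>2 * \<epsilon>\<^sup>2 / 26) * real \<Delta>"
    by (simp add: b0 rate_def power2_eq_square)
  finally show ?thesis .
qed

text \<open>The load for \<open>None\<close> is the remaining degree. Divided by \<Delta>, its
  target at the horizon is at most 2 tail \<epsilon> = \<epsilon>^2 / 32, and the budget adds at
  most as much.\<close>

lemma degree_rest_le:
  assumes \<sigma>: "\<sigma> \<in> edge_orders E m" and h: "h \<in> set_pmf (play (obl E \<sigma>) greedy horizon)"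
    and good: "good h" and v: "v < n"
  shows "real (degree (rest h) v) \<le> \<epsilon>\<^sup>2 / 16 * real \<Delta>"
proof -
  interpret S: tracked_state \<epsilon> "budget horizon" \<Delta> g "{..<n}" "free h" "rest h" "target horizon"
    by (rule tracked[OF \<sigma> h good horizon_bounds(1)])
  have "load g (free h) (rest h) v None = real (degree (rest h) v)"
    using card_nbrs[of "rest h" v] S.card_R by (simp add: load_def weight_def)
  then have "real (degree (rest h) v) / real \<Delta> \<le> target horizon v + budget horizon"
    using S.load_near[of v None] v by simp
  also have "target horizon v \<le> 2 * tail \<epsilon> * 1"
  proof (intro mult_mono)
    show "1 - real horizon / real m \<le> 2 * tail \<epsilon>"
      using horizon_bounds(3) m_pos by (simp add: field_simps)
    show "real (degree E v) / real \<Delta> \<le> 1" using degree_le[of v] Delta_pos by simp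
  qed (use tail_pos in auto)
  also have "2 * tail \<epsilon> * 1 + budget horizon \<le> \<epsilon>\<^sup>2 / 16"
    using budget_le[OF horizon_bounds(1)] by (simp add: tail_def)
  finally show ?thesis using Delta_pos by (simp add: field_simps)
qed

text \<open>Up to the horizon, overlaps near 1 keep every edge colorable. Afterwards the overlaps
  are no longer controlled, and the monotone slack takes over from the state at the horizon.\<close>

lemma good_imp_wins:
  assumes \<sigma>: "\<sigma> \<in> edge_orders E m" and h: "h \<in> set_pmf (play (obl E \<sigma>) greedy m)"
    and good: "good (take horizon h)"
  shows "colorer_wins {..<g} h"
proof -
  note len = length_play[OF h]
  have colored: "snd (h ! k) \<noteq> None" if k: "k < m" for k
  proof -
    define h' where "h' = take k h"
    have h': "h' \<in> set_pmf (play (obl E \<sigma>) greedy k)"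
      unfolding h'_def using k by (intro take_play[OF h]) simp
    define e where "e = obl E \<sigma> h'"
    have "snd (h ! k) \<in> set_pmf (greedy h' e)"
      using nth_play[OF h k] by (simp add: h'_def e_def)
    moreover have "admissible g (free h') e \<noteq> {}"
    proof (cases "e = {}")
      case True
      then show ?thesis using g_pos by (auto simp: admissible_def)
    next
      case False
      have "e \<in> insert {} (rest h')"
        using slot_cases[OF \<sigma>, of k "Suc k"] length_play[OF h']
        unfolding unplayed_play[OF \<sigma> h' empty_notin] by (simp add: e_def obl_eq_slot)
      then have e: "e \<in> rest h'" using False by simp
      show ?thesis
      proof (cases "k < horizon")
        case True
        then have "h' = take k (take horizon h)" by (simp add: h'_def)
        then have "good h'" using tame_take[OF good] by simp
        then interpret S: tracked_state \<epsilon> "budget k" \<Delta> g "{..<n}" "free h'" "rest h'" "target k"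
          using k by (intro tracked[OF \<sigma> h']) auto
        show ?thesis by (rule S.admissible_nonempty[OF e])
      next
        case False
        define h0 where "h0 = take horizon h"
        have h0: "h0 \<in> set_pmf (play (obl E \<sigma>) greedy horizon)"
          unfolding h0_def using horizon_bounds(1) by (intro take_play[OF h])
        interpret S: tracked_state \<epsilon> "budget horizon" \<Delta> g "{..<n}" "free h0" "rest h0" "target horizon"
          using good by (intro tracked[OF \<sigma> h0 _ horizon_bounds(1)]) (simp add: h0_def)
        have eE: "e \<subseteq> {..<n}" "card e = 2" using e edgeD by (auto simp: unplayed_def)
        then obtain u v where uv: "e = {u, v}" "u \<noteq> v" "u < n" "v < n" by (auto simp: card_2_iff)
        have "\<epsilon>\<^sup>2 * real \<Delta> / 4 \<le> real (card (admissible g (free h0) e))"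
          using S.card_Int_ge[of u v] uv by (simp add: S.admissible_pair)
        moreover have "(\<Sum>w\<in>e. real (degree (rest h0) w)) \<le> real (card e) * (\<epsilon>\<^sup>2 / 16 * real \<Delta>)"
          using degree_rest_le[OF \<sigma> h0] good eE(1) by (intro sum_bounded_above) (auto simp: h0_def)
        moreover have "0 < \<epsilon>\<^sup>2 * real \<Delta>" using eps Delta_pos by simp
        \<comment> \<open>At least \<epsilon>^2 \<Delta> / 4 common colors face at most 2
          \<epsilon>^2 \<Delta> / 16 edges still to come at the two ends.\<close>
        ultimately have "0 < slack g E e h0" unfolding slack_def eE(2) by linarith
        also have "h0 = take horizon h'" using False by (simp add: h0_def h'_def min_def)
        also have "slack g E e (take horizon h') \<le> slack g E e h'"
          using False eE by (intro slack_mono[OF finite_E empty_notin _ \<sigma> h']) (auto intro: finite_subset)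
        also have "\<dots> \<le> real (card (admissible g (free h') e))"
          by (simp add: slack_def sum_nonneg)
        finally show ?thesis by auto
      qed
    qed
    ultimately show ?thesis
      by (auto simp: randomized_greedy_def admissible_def Let_def split: if_splits)
  qed
  show ?thesis
    unfolding colorer_wins_def
    using colored randomized_greedy_proper[OF _ h] len by (auto simp: in_set_conv_nth) (metis snd_conv)
qed

text \<open>Losing the full game forces its prefix up to the horizon out of the good event, and a
  probability under \<open>random_play\<close> is the average over the orders; so the bound for a
  random order becomes one for the sum over all orders.\<close>

lemma sum_prob_loses_le:
  "(\<Sum>\<sigma>\<in>edge_orders E m. measure_pmf.prob (play (obl E \<sigma>) greedy m) {h. \<not> colorer_wins {..<g} h})
    \<le> real (card (edge_orders E m)) *
      (2 * real (n * n + n * (g + 1)) * exp (- ((base \<epsilon>)\<^sup>2 * \<epsilon>\<^sup>2 / 26) * real \<Delta>))"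
proof -
  define Os where "Os = edge_orders E m"
  have Os: "finite Os" "Os \<noteq> {}" using finite_edge_orders[OF finite_E] orders by (auto simp: Os_def)
  have le: "measure_pmf.prob (play (obl E \<sigma>) greedy m) {h. \<not> colorer_wins {..<g} h} \<le>
      measure_pmf.prob (play (obl E \<sigma>) greedy horizon) {h. \<not> good h}" if "\<sigma> \<in> Os" for \<sigma>
  proof -
    have "measure_pmf.prob (play (obl E \<sigma>) greedy m) {h. \<not> colorer_wins {..<g} h} \<le>
        measure_pmf.prob (play (obl E \<sigma>) greedy m) (take horizon -` {h. \<not> good h})"
      using good_imp_wins that by (intro measure_pmf.finite_measure_mono_AE AE_pmfI) (auto simp: Os_def)
    also have "\<dots> = measure_pmf.prob (map_pmf (take horizon) (play (obl E \<sigma>) greedy m)) {h. \<not> good h}"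
      by simp
    finally show ?thesis by (simp only: map_pmf_take_play[OF horizon_bounds(1)])
  qed
  have "ennreal (measure_pmf.prob (random_play E m greedy horizon) {h. \<not> good h}) =
      emeasure (random_play E m greedy horizon) {h. \<not> good h}"
    by (simp add: measure_pmf.emeasure_eq_measure)
  also have "\<dots> = (\<Sum>\<sigma>\<in>Os. emeasure (play (obl E \<sigma>) greedy horizon) {h. \<not> good h}) / real (card Os)"
    using Os by (simp add: random_play_def Os_def[symmetric] nn_integral_pmf_of_set ennreal_of_nat_eq_real_of_nat)
  also have "\<dots> = ennreal ((\<Sum>\<sigma>\<in>Os. measure_pmf.prob (play (obl E \<sigma>) greedy horizon) {h. \<not> good h})
      / real (card Os))"
    using Os by (simp add: measure_pmf.emeasure_eq_measure sum_nonneg divide_ennreal card_gt_0_iff)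
  finally have "measure_pmf.prob (random_play E m greedy horizon) {h. \<not> good h} =
      (\<Sum>\<sigma>\<in>Os. measure_pmf.prob (play (obl E \<sigma>) greedy horizon) {h. \<not> good h}) / real (card Os)"
    by (simp add: sum_nonneg)
  then have "(\<Sum>\<sigma>\<in>Os. measure_pmf.prob (play (obl E \<sigma>) greedy horizon) {h. \<not> good h}) =
      real (card Os) * measure_pmf.prob (random_play E m greedy horizon) {h. \<not> good h}"
    using Os by simp
  also have "\<dots> \<le> real (card Os) *
      (2 * real (n * n + n * (g + 1)) * exp (- ((base \<epsilon>)\<^sup>2 * \<epsilon>\<^sup>2 / 26) * real \<Delta>))"
    using prob_not_good_le by (intro mult_left_mono) auto
  finally have "(\<Sum>\<sigma>\<in>Os. measure_pmf.prob (play (obl E \<sigma>) greedy horizon) {h. \<not> good h}) \<le> real (card Os) *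
      (2 * real (n * n + n * (g + 1)) * exp (- ((base \<epsilon>)\<^sup>2 * \<epsilon>\<^sup>2 / 26) * real \<Delta>))" .
  then show ?thesis
    using sum_mono[of Os, OF le] unfolding Os_def by (rule order_trans[rotated])
qed

end

section \<open>Choice of the constants and Markov's inequality\<close>

lemma max_degree_bounds:
  assumes G: "simple_graph n E" and n: "0 < n"
  shows "degree E v \<le> max_degree n E" "max_degree n E \<le> n"
proof -
  have edge: "e \<subseteq> {..<n}" "card e = 2" if "e \<in> E" for e
    using G that by (auto simp: simple_graph_def)
  have "degree E v \<le> n" for v
  proof -
    have "nbrs E v \<subseteq> {..<n}" using edge by (fastforce simp: nbrs_def)
    then have "card (nbrs E v) \<le> card {..<n}" by (intro card_mono) auto
    then show ?thesis using card_nbrs[of E v] edge by simp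
  qed
  moreover have "max_degree n E \<in> degree E ` {..<n}"
    unfolding max_degree_def using n by (intro Max_in) auto
  ultimately show "max_degree n E \<le> n" by auto
  show "degree E v \<le> max_degree n E"
  proof (cases "v < n")
    case True
    then show ?thesis unfolding max_degree_def by (intro Max_ge) auto
  next
    case False
    then have "{e \<in> E. v \<in> e} = {}" using edge by fastforce
    then show ?thesis by (simp only: degree_def card.empty le0)
  qed
qed

lemma exp_le_two_powr:
  assumes "0 \<le> (x :: real)"
  shows "exp (- x) \<le> 2 powr (- x)"
proof -
  have "ln 2 \<le> (1 :: real)" using ln_le_minus_one[of 2] by simp
  then have "x * ln 2 \<le> x * 1" using assms by (intro mult_left_mono)
  then show ?thesis by (simp add: powr_def)
qed

theorem mainTheorem1:
  fixes \<epsilon> :: real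
  assumes "0 < \<epsilon>" and "\<epsilon> < 1"
  shows "\<exists>N::real. \<exists>\<gamma>1::real. \<exists>\<gamma>2::real. N > 0 \<and> \<gamma>1 > 0 \<and> \<gamma>2 > 0 \<and>
    (\<exists>n0::nat. \<forall>n\<ge>n0. \<forall>\<Delta>::nat. real \<Delta> > N * ln (real n) \<longrightarrow>
      (\<forall>E. simple_graph n E \<and> max_degree n E = \<Delta> \<longrightarrow>
        real (card {\<sigma> \<in> edge_orders E (game_length n \<Delta>).
                \<not> win_prob n \<Delta> \<epsilon> (obl E \<sigma>) (randomized_greedy (palette \<epsilon> \<Delta>))
                    \<ge> 1 - 2 powr (- \<gamma>2 * real \<Delta>)})
          \<le> 2 powr (- \<gamma>1 * real \<Delta>) * real (card (edge_orders E (game_length n \<Delta>)))))"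
proof -
  define c where "c = (base \<epsilon>)\<^sup>2 * \<epsilon>\<^sup>2 / 26"
  have base: "0 < base \<epsilon>" using assms by (simp add: base_def)
  have c: "0 < c" using base assms by (simp add: c_def)
  \<comment> \<open>c is the exponent in \<open>sum_prob_loses_le\<close>. With N = 8/c the factor
    n^2 is at most exp (c\<Delta>/4), and so is the constant 8; what remains is exp (-c\<Delta>/2) =
    exp (-2\<gamma>\<Delta>). One factor goes to the fraction of bad orders, the other to the
    failure probability.\<close>
  define \<gamma> where "\<gamma> = c / 4"
  define N where "N = 8 / c"
  define \<Delta>0 where "\<Delta>0 = max (1 / base \<epsilon>) (32 / c)"
  \<comment> \<open>The first summand forces N ln n \<ge> \<Delta>0 and hence \<Delta> > \<Delta>0;
    the second gives m \<ge> growth \<epsilon> * \<Delta> in spite of the rounding in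
    \<open>game_length\<close>; the last makes the vertex set nonempty.\<close>
  define n0 where "n0 = nat \<lceil>exp (\<Delta>0 / N)\<rceil> + nat \<lceil>2 * growth \<epsilon> + 1\<rceil> + 1"
  have pos: "0 < N" "0 < \<gamma>" using c by (auto simp: N_def \<gamma>_def)
  have main: "real (card {\<sigma> \<in> edge_orders E (game_length n \<Delta>).
                \<not> win_prob n \<Delta> \<epsilon> (obl E \<sigma>) (randomized_greedy (palette \<epsilon> \<Delta>))
                    \<ge> 1 - 2 powr (- \<gamma> * real \<Delta>)})
          \<le> 2 powr (- \<gamma> * real \<Delta>) * real (card (edge_orders E (game_length n \<Delta>)))"
    if n: "n0 \<le> n" and Delta: "N * ln (real n) < real \<Delta>"
      and G: "simple_graph n E" "max_degree n E = \<Delta>" for n \<Delta> E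
  \<comment> \<open>If there are no orders, both sides are 0; otherwise the uniform distribution on
    the orders is available.\<close>
  proof (cases "edge_orders E (game_length n \<Delta>) = {}")
    case False
    have n_ge: "exp (\<Delta>0 / N) \<le> real n" "2 * growth \<epsilon> + 1 \<le> real n" "1 \<le> n"
      using n by (auto simp: n0_def) linarith+
    have "\<Delta>0 / N \<le> ln (real n)"
      using n_ge by (simp add: ln_ge_iff)
    then have "\<Delta>0 \<le> N * ln (real n)" using pos by (simp add: field_simps)
    then have D: "\<Delta>0 < real \<Delta>" using Delta by simp
    have large: "1 \<le> base \<epsilon> * real \<Delta>" "8 \<le> c * real \<Delta> / 4"
      using D base c by (auto simp: \<Delta>0_def field_simps)
    \<comment> \<open>The palette thus has at most 2n colors, which makes the number of tracked
      indices at most quadratic in n.\<close>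
    have Dn: "\<Delta> \<le> n" using max_degree_bounds(2)[OF G(1)] n_ge(3) G(2) by simp
    define g where "g = nat \<lceil>(1 + \<epsilon>) * real \<Delta>\<rceil>"
    define m where "m = game_length n \<Delta>"
    have pal: "palette \<epsilon> \<Delta> = {..<g}" by (simp add: palette_def g_def)
    have D1: "1 \<le> real \<Delta>" using large(1) by (cases "\<Delta> = 0") auto
    interpret random_order_game \<epsilon> n \<Delta> m g E
    proof
      show "0 < \<epsilon>" "\<epsilon> < 1" "simple_graph n E" "1 \<le> base \<epsilon> * real \<Delta>" "edge_orders E m \<noteq> {}"
        using assms G large False by (auto simp: m_def)
      show "degree E v \<le> \<Delta>" for v using max_degree_bounds(1)[OF G(1)] n_ge(3) G(2) by simp
      show "(1 + \<epsilon>) * real \<Delta> \<le> real g" unfolding g_def by linarith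
      have "(1 + \<epsilon>) * real \<Delta> \<le> 2 * real \<Delta>" using assms by (intro mult_right_mono) auto
      then have "\<lceil>(1 + \<epsilon>) * real \<Delta>\<rceil> \<le> int (2 * \<Delta>)" by (simp add: ceiling_le_iff)
      then show "g \<le> 2 * \<Delta>" unfolding g_def by linarith
      have "q \<le> 2 * (q div 2) + 1" for q :: nat by presburger
      then have "real (\<Delta> * n) \<le> real (2 * m + 1)"
        unfolding m_def game_length_def of_nat_le_iff .
      then have m: "(real (\<Delta> * n) - 1) / 2 \<le> real m" by simp
      have "growth \<epsilon> * real \<Delta> \<le> (real n - 1) / 2 * real \<Delta>"
        using n_ge(2) by (intro mult_right_mono) auto
      also have "\<dots> \<le> (real (\<Delta> * n) - 1) / 2" using D1 by (simp add: field_simps)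
      also note m
      finally show "growth \<epsilon> * real \<Delta> \<le> real m" .
    qed
    define lose where "lose = (\<lambda>\<sigma>. measure_pmf.prob (play (obl E \<sigma>) greedy m) {h. \<not> colorer_wins {..<g} h})"
    define bad where "bad = {\<sigma> \<in> edge_orders E m. 2 powr (- \<gamma> * real \<Delta>) < lose \<sigma>}"
    have bad: "{\<sigma> \<in> edge_orders E (game_length n \<Delta>).
        \<not> win_prob n \<Delta> \<epsilon> (obl E \<sigma>) (randomized_greedy (palette \<epsilon> \<Delta>)) \<ge> 1 - 2 powr (- \<gamma> * real \<Delta>)} = bad"
    proof -
      have "win_prob n \<Delta> \<epsilon> (obl E \<sigma>) (randomized_greedy (palette \<epsilon> \<Delta>)) = 1 - lose \<sigma>" for \<sigma>
        using measure_pmf.prob_neg[of "play (obl E \<sigma>) greedy m" "colorer_wins {..<g}"]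
        by (simp add: win_prob_def pal lose_def m_def)
      then show ?thesis by (auto simp: bad_def m_def)
    qed
    have "2 * real (n * n + n * (g + 1)) * exp (- c * real \<Delta>) \<le> 8 * (real n)\<^sup>2 * exp (- c * real \<Delta>)"
    proof (intro mult_right_mono)
      have "g + 1 \<le> 3 * n" using g_le Dn n_ge(3) by linarith
      then have "n * (g + 1) \<le> n * (3 * n)" by (rule mult_le_mono2)
      then have "real (n * n + n * (g + 1)) \<le> real (4 * (n * n))" by (subst of_nat_le_iff) simp
      then show "2 * real (n * n + n * (g + 1)) \<le> 8 * (real n)\<^sup>2" by (simp add: power2_eq_square)
    qed simp
    also have "(real n)\<^sup>2 = exp (2 * ln (real n))"
      using n_ge(3) exp_of_nat_mult[of 2 "ln (real n)"] by simp
    also have "8 * exp (2 * ln (real n)) * exp (- c * real \<Delta>) \<le>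
        exp (c * real \<Delta> / 4) * exp (c * real \<Delta> / 4) * exp (- c * real \<Delta>)"
    proof (intro mult_right_mono mult_mono)
      show "8 \<le> exp (c * real \<Delta> / 4)"
        using exp_ge_add_one_self[of "c * real \<Delta> / 4"] large(2) by linarith
      show "exp (2 * ln (real n)) \<le> exp (c * real \<Delta> / 4)"
        using Delta c by (simp add: N_def field_simps)
    qed auto
    also have "\<dots> = exp (- (2 * \<gamma> * real \<Delta>))"
      by (simp add: exp_add[symmetric] \<gamma>_def)
    also have "\<dots> \<le> 2 powr (- (2 * \<gamma> * real \<Delta>))"
      using pos by (intro exp_le_two_powr) simp
    also have "\<dots> = 2 powr (- \<gamma> * real \<Delta>) * 2 powr (- \<gamma> * real \<Delta>)"
      by (simp add: powr_add[symmetric] mult.assoc)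
    finally have small: "2 * real (n * n + n * (g + 1)) * exp (- c * real \<Delta>) \<le>
        2 powr (- \<gamma> * real \<Delta>) * 2 powr (- \<gamma> * real \<Delta>)" .
    have fin: "finite (edge_orders E m)" by (rule finite_edge_orders[OF finite_E])
    \<comment> \<open>Markov's inequality for the losing probability of a uniformly random
      order.\<close>
    have "real (card bad) * 2 powr (- \<gamma> * real \<Delta>) \<le> sum lose bad"
      using sum_bounded_below[of bad "2 powr (- \<gamma> * real \<Delta>)" lose] by (auto simp: bad_def)
    also have "\<dots> \<le> sum lose (edge_orders E m)"
      using fin by (intro sum_mono2) (auto simp: bad_def lose_def)
    also have "\<dots> \<le> real (card (edge_orders E m)) *
        (2 * real (n * n + n * (g + 1)) * exp (- c * real \<Delta>))"
      using sum_prob_loses_le by (simp add: lose_def c_def)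
    also have "\<dots> \<le> real (card (edge_orders E m)) *
        (2 powr (- \<gamma> * real \<Delta>) * 2 powr (- \<gamma> * real \<Delta>))"
      by (rule mult_left_mono[OF small]) simp
    finally have "real (card bad) * 2 powr (- \<gamma> * real \<Delta>) \<le>
        (2 powr (- \<gamma> * real \<Delta>) * real (card (edge_orders E m))) * 2 powr (- \<gamma> * real \<Delta>)"
      by (simp only: mult_ac)
    then have "real (card bad) \<le> 2 powr (- \<gamma> * real \<Delta>) * real (card (edge_orders E m))"
      by (rule mult_right_le_imp_le) simp
    then show ?thesis unfolding bad m_def .
  qed simp
  show ?thesis
    using pos main by (intro exI[of _ N] exI[of _ \<gamma>] exI[of _ n0] conjI allI impI) auto
qed

end
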